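(* Let $n=1$, $\delta>0$, $\beta<1$. If $f\in L^2(T)$ is piecewise continuous and $u$ is the solution of $u_t=L^{\delta,\beta}u$ on $T$, $t>0$, $u(\cdot,0)=f$, then for every $t>0$ the function $u(\cdot,t)$ is piecewise continuous, and $f$ and $u(\cdot,t)$ share the same locations of jumps. Furthermore, the magnitude of a jump decays as $t$ increases (i.e. at each jump location it is a decreasing function of $t$).
   Context: Let $r>0$ and let $T=[0,r]$ be the one-dimensional periodic torus (endpoints identified); for $k\in\mathbb{Z}$ put $\nu_k=2\pi k/r$, and write Fourier series as $h=\sum_{k\in\mathbb{Z}}\hat h_k e^{i\nu_kx}$. Piecewise continuous means continuous except at finitely many points of $T$, at which finite one-sided limits exist; a jump is a point where the one-sided limits differ, and its magnitude is the absolute value of their difference. For $\beta<1$ the operator is $L^{\delta,\beta}u(x)=c^{\delta,\beta}\int_{x-\delta}^{x+\delta}\frac{u(y)-u(x)}{|y-x|^\beta}dy$ with $c^{\delta,\beta}=\frac{2(3-\beta)\Gamma(\frac32)}{\pi^{1/2}\delta^{3-\beta}}$ (functions extended periodically), which acts on Fourier series by multiplication of the $k$-th coefficient by $m(\nu_k)$, where $m(\nu)=c^{\delta,\beta}\int_{-\delta}^{\delta}\frac{\cos(\nu z)-1}{|z|^\beta}dz$. The solution in $L^2(T)$ is $\sum_k\hat f_k e^{m(\nu_k)t}e^{i\nu_kx}$. Pointwise, $u(x,t)=v(x,t)+e^{-\alpha t}f(x)$ with $\alpha=\frac{2(3-\beta)}{\delta^2(1-\beta)}$, where $v(\cdot,t)$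 is the $L^2(T)$ function with Fourier coefficients $\hat v_k(t)=\hat f_k\left(1-e^{-(m(\nu_k)+\alpha)t}\right)e^{m(\nu_k)t}$, given by its continuous representative whenever one exists. *)

theory Defs
  imports "HOL-Analysis.Analysis" "HOL-Library.Periodic_Fun"
begin

text \<open>
  Functions on the one-dimensional torus $T = [0,r]$ (endpoints identified) are represented by
  their $r$-periodic extensions to the real line; points of $T$ are represented by $0 \le x < r$.
  One-sided limits at the point $0$ of $T$ are therefore those of the periodic extension.
\<close>

definition square_integrable_torus :: "real \<Rightarrow> (real \<Rightarrow> complex) \<Rightarrow> bool" where
  "square_integrable_torus r g \<longleftrightarrow>
     periodic_fun_simple g r \<and>
     g \<in> borel_measurable (lebesgue_on {0..r}) \<and>
     integrable (lebesgue_on {0..r}) (\<lambda>x. (norm (g x))\<^sup>2)"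

text \<open>Only meaningful for square integrable functions, as divergent integrals are $0$.\<close>

definition L2_norm_torus :: "real \<Rightarrow> (real \<Rightarrow> complex) \<Rightarrow> real" where
  "L2_norm_torus r g = sqrt (integral\<^sup>L (lebesgue_on {0..r}) (\<lambda>x. (norm (g x))\<^sup>2))"

definition freq :: "real \<Rightarrow> int \<Rightarrow> real" where
  "freq r k = 2 * pi * of_int k / r"

definition fourier_coeff :: "real \<Rightarrow> (real \<Rightarrow> complex) \<Rightarrow> int \<Rightarrow> complex" where
  "fourier_coeff r g k =
     (1 / of_real r) *
     integral\<^sup>L (lebesgue_on {0..r}) (\<lambda>x. g x * exp (- \<i> * of_real (freq r k * x)))"

definition piecewise_continuous_torus :: "real \<Rightarrow> (real \<Rightarrow> complex) \<Rightarrow> bool" where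
  "piecewise_continuous_torus r g \<longleftrightarrow>
     periodic_fun_simple g r \<and>
     (\<exists>S. finite S \<and> S \<subseteq> {0..<r} \<and>
        (\<forall>x\<in>{0..<r} - S. isCont g x) \<and>
        (\<forall>x\<in>S. (\<exists>l. (g \<longlongrightarrow> l) (at_left x)) \<and> (\<exists>l. (g \<longlongrightarrow> l) (at_right x))))"

definition jumps :: "real \<Rightarrow> (real \<Rightarrow> complex) \<Rightarrow> real set" where
  "jumps r g =
     {x\<in>{0..<r}. \<exists>a b. (g \<longlongrightarrow> a) (at_left x) \<and> (g \<longlongrightarrow> b) (at_right x) \<and> a \<noteq> b}"

definition jump_magnitude :: "(real \<Rightarrow> complex) \<Rightarrow> real \<Rightarrow> real" where
  "jump_magnitude g x = norm (Lim (at_right x) g - Lim (at_left x) g)"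

definition nonlocal_const :: "real \<Rightarrow> real \<Rightarrow> real" where
  "nonlocal_const \<delta> \<beta> =
     2 * (3 - \<beta>) * Gamma (3 / 2) / (pi powr (1 / 2) * \<delta> powr (3 - \<beta>))"

text \<open>
  The value of the integrands below at the single point where the denominator is $0$ powr
  $\beta = 0$ is the dummy value $0$, which does not affect the integrals.
\<close>

definition nonlocal_op :: "real \<Rightarrow> real \<Rightarrow> (real \<Rightarrow> complex) \<Rightarrow> real \<Rightarrow> complex" where
  "nonlocal_op \<delta> \<beta> g x =
     of_real (nonlocal_const \<delta> \<beta>) *
     integral\<^sup>L (lebesgue_on {x - \<delta>..x + \<delta>})
       (\<lambda>y. (g y - g x) / of_real (\<bar>y - x\<bar> powr \<beta>))"

definition nonlocal_multiplier :: "real \<Rightarrow> real \<Rightarrow> real \<Rightarrow> real" where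
  "nonlocal_multiplier \<delta> \<beta> \<nu> =
     nonlocal_const \<delta> \<beta> *
     integral\<^sup>L (lebesgue_on {-\<delta>..\<delta>}) (\<lambda>z. (cos (\<nu> * z) - 1) / \<bar>z\<bar> powr \<beta>)"

definition decay_rate :: "real \<Rightarrow> real \<Rightarrow> real" where
  "decay_rate \<delta> \<beta> = 2 * (3 - \<beta>) / (\<delta>\<^sup>2 * (1 - \<beta>))"

text \<open>
  The space-time function is curried with time first, so that \<open>u t\<close> is $u(\cdot,t)$.
  The equation $u_t = L u$ is understood in $L^2(T)$, that is, \<open>t \<mapsto> u t\<close> is differentiable in
  the $L^2(T)$ norm.
\<close>

definition nonlocal_solution ::
  "real \<Rightarrow> real \<Rightarrow> real \<Rightarrow> (real \<Rightarrow> complex) \<Rightarrow> (real \<Rightarrow> real \<Rightarrow> complex) \<Rightarrow> bool" where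
  "nonlocal_solution r \<delta> \<beta> f u \<longleftrightarrow>
     u 0 = f \<and>
     (\<forall>t\<ge>0. square_integrable_torus r (u t)) \<and>
     ((\<lambda>t. L2_norm_torus r (\<lambda>x. u t x - f x)) \<longlongrightarrow> 0) (at_right 0) \<and>
     (\<forall>t>0. square_integrable_torus r (nonlocal_op \<delta> \<beta> (u t)) \<and>
        ((\<lambda>h. L2_norm_torus r
            (\<lambda>x. (u (t + h) x - u t x) / of_real h - nonlocal_op \<delta> \<beta> (u t) x))
          \<longlongrightarrow> 0) (at 0))"

text \<open>
  An $L^2$ solution is determined only up to null sets at each time. Its pointwise values are
  fixed by $u(x,t) = v(x,t) + e^{-\alpha t} f(x)$, where $v(\cdot,t)$ is the $L^2(T)$ function
  with the Fourier coefficients given below, taken to be its continuous representative if it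
  has one.
\<close>

definition pointwise_values ::
  "real \<Rightarrow> real \<Rightarrow> real \<Rightarrow> (real \<Rightarrow> complex) \<Rightarrow> (real \<Rightarrow> real \<Rightarrow> complex) \<Rightarrow> bool" where
  "pointwise_values r \<delta> \<beta> f u \<longleftrightarrow>
     (\<exists>v. \<forall>t>0.
        square_integrable_torus r (v t) \<and>
        (\<forall>k. fourier_coeff r (v t) k =
           fourier_coeff r f k *
           of_real ((1 - exp (- (nonlocal_multiplier \<delta> \<beta> (freq r k) + decay_rate \<delta> \<beta>) * t)) *
                    exp (nonlocal_multiplier \<delta> \<beta> (freq r k) * t))) \<and>
        ((\<exists>g. periodic_fun_simple g r \<and> continuous_on UNIV g \<and> (AE x in lebesgue. g x = v t x))
           \<longrightarrow> continuous_on UNIV (v t)) \<and>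
        (\<forall>x. u t x = v t x + of_real (exp (- decay_rate \<delta> \<beta> * t)) * f x))"

end

theory Submission
  imports Defs
begin

text \<open>
  Put $K(z) = c^{\delta,\beta} |z|^{-\beta}$ on $[-\delta,\delta]$ and $0$ elsewhere. Then $K$ is
  integrable with $\int K = \alpha$, and $m(\nu) + \alpha$ is its Fourier transform. Expanding
  \[ e^{m t} - e^{-\alpha t} = e^{-\alpha t} \sum_{j \ge 1} \frac{t^j}{j!} (m + \alpha)^j \]
  shows that $v(\cdot,t)$ has the Fourier coefficients of
  $e^{-\alpha t} \sum_{j \ge 1} \frac{t^j}{j!} K^{*j} * f$. Each $K^{*j} * f$ with $j \ge 1$ is
  continuous because $f$ is bounded with countably many discontinuities, and
  $\|K^{*j} * f\|_\infty \le \alpha^j \|f\|_\infty$, so the series converges uniformly. By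
  uniqueness of Fourier coefficients $v(\cdot,t)$ agrees with this continuous function almost
  everywhere, hence is itself continuous. The jumps of $u(\cdot,t)$ are therefore those of
  $e^{-\alpha t} f$.
\<close>

text \<open>Estimating the Fourier series of v directly would mean summing the coefficients of f
  against m + \<alpha>. Only square summability of the former is at hand, and m + \<alpha>, the
  transform of a truncated power |z|^(-\<beta>), decays no faster than |\<nu>|^(\<beta> - 1) when 0
  < \<beta> < 1. It therefore stops being square summable over the frequencies at \<beta> = 1/2.
  Working with the kernel itself treats all \<beta> < 1 alike.

  The constant \<alpha> is the limit of -m at high frequency, because m + \<alpha> tends to 0 by the
  Riemann-Lebesgue lemma. This is why exactly the multiple e^(-\<alpha> t) f escapes smoothing and
  why each jump is multiplied by e^(-\<alpha> t).

  Since v is given only through its coefficients, the continuous candidate can be matched with it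
  only by a uniqueness theorem. That theorem is proved for integrable functions, with trigonometric
  polynomials supplied by Stone-Weierstrass on the unit circle.\<close>

section \<open>Uniqueness of Fourier coefficients\<close>

lemma integrable_mult_bounded_torus:
  fixes h g :: "real \<Rightarrow> complex"
  assumes "integrable (lebesgue_on {0..r}) h"
    and "g \<in> borel_measurable (lebesgue_on {0..r})" and "\<And>x. norm (g x) \<le> B"
  shows "integrable (lebesgue_on {0..r}) (\<lambda>x. h x * g x)"
proof (rule Bochner_Integration.integrable_bound)
  show "integrable (lebesgue_on {0..r}) (\<lambda>x. B *\<^sub>R h x)"
    using assms by simp
  show "(\<lambda>x. h x * g x) \<in> borel_measurable (lebesgue_on {0..r})"
    using assms by measurable
  show "AE x in lebesgue_on {0..r}. norm (h x * g x) \<le> norm (B *\<^sub>R h x)"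
  proof (rule AE_I2)
    fix x
    have "norm (h x * g x) \<le> norm (h x) * B"
      using assms(3)[of x] by (simp add: norm_mult mult_left_mono)
    also have "\<dots> \<le> norm (B *\<^sub>R h x)"
      by (simp add: mult.commute mult_right_mono)
    finally show "norm (h x * g x) \<le> norm (B *\<^sub>R h x)" .
  qed
qed

lemma continuous_on_imp_measurable_torus:
  fixes g :: "real \<Rightarrow> 'b::euclidean_space"
  assumes "continuous_on UNIV g"
  shows "g \<in> borel_measurable (lebesgue_on S)"
proof -
  have "g \<in> borel_measurable lborel"
    using assms by (simp add: borel_measurable_continuous_onI)
  then have "g \<in> borel_measurable lebesgue"
    by (rule measurable_completion)
  then show ?thesis
    by (rule measurable_restrict_space1)
qed

lemma freq_add: "freq r (k + l) = freq r k + freq r l"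
  by (simp add: freq_def add_divide_distrib distrib_left)

text \<open>Multiplication by a character only shifts the frequencies, so a function all of whose
  coefficients vanish keeps this property. This drives the induction over polynomials.\<close>

lemma fourier_coeff_mult_exp:
  "fourier_coeff r (\<lambda>x. h x * exp (- \<i> * of_real (freq r l * x))) k = fourier_coeff r h (k + l)"
proof -
  have "h x * exp (- \<i> * of_real (freq r l * x)) * exp (- \<i> * of_real (freq r k * x)) =
      h x * exp (- \<i> * of_real (freq r (k + l) * x))" for x
    by (simp add: freq_add exp_add[symmetric] algebra_simps)
  then show ?thesis
    by (simp only: fourier_coeff_def)
qed

lemma integrable_mult_exp:
  assumes "integrable (lebesgue_on {0..r}) h"
  shows "integrable (lebesgue_on {0..r}) (\<lambda>x. h x * exp (- \<i> * of_real (freq r l * x)))"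
  by (rule integrable_mult_bounded_torus[OF assms, of _ 1])
     (auto intro!: continuous_on_imp_measurable_torus continuous_intros)

lemma fourier_coeff_add:
  assumes "integrable (lebesgue_on {0..r}) g" "integrable (lebesgue_on {0..r}) h"
  shows "fourier_coeff r (\<lambda>x. g x + h x) k = fourier_coeff r g k + fourier_coeff r h k"
  using integrable_mult_exp[OF assms(1), of k] integrable_mult_exp[OF assms(2), of k]
  unfolding fourier_coeff_def by (simp add: distrib_right distrib_left)

lemma fourier_coeff_cmult: "fourier_coeff r (\<lambda>x. c * h x) k = c * fourier_coeff r h k"
  unfolding fourier_coeff_def by (simp add: mult.assoc)

text \<open>On the unit circle a real-linear functional is a combination of cos and sin, hence of
  the harmonics 1 and -1. This is the linear base case of
  \<open>real_polynomial_function\<close>.\<close>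

lemma bounded_linear_cis:
  assumes "bounded_linear (p :: complex \<Rightarrow> real)"
  shows "complex_of_real (p (cis y)) =
    Complex (p 1) (p \<i>) / 2 * exp (- \<i> * of_real y) + Complex (p 1) (- p \<i>) / 2 * exp (\<i> * of_real y)"
proof -
  interpret bounded_linear p by fact
  have "cis y = cos y *\<^sub>R 1 + sin y *\<^sub>R \<i>" by (simp add: complex_eq_iff)
  then have "p (cis y) = cos y * p 1 + sin y * p \<i>"
    by (simp add: add scaleR del: scaleR_complex.simps)
  moreover have "exp (- \<i> * of_real y) = cis (-y)" "exp (\<i> * of_real y) = cis y"
    by (simp_all add: cis_conv_exp)
  ultimately show ?thesis
    by (simp add: complex_eq_iff field_simps)
qed

text \<open>
  Leaving \<open>h\<close> arbitrary makes the product case immediate: multiplication by the first factor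
  yields another function with vanishing Fourier coefficients.
\<close>

lemma real_polynomial_function_orthogonal:
  assumes "real_polynomial_function p"
    and "integrable (lebesgue_on {0..r}) h" "\<And>k. fourier_coeff r h k = 0"
  shows "integrable (lebesgue_on {0..r}) (\<lambda>x. h x * of_real (p (cis (2 * pi * x / r)))) \<and>
    (\<forall>k. fourier_coeff r (\<lambda>x. h x * of_real (p (cis (2 * pi * x / r)))) k = 0)"
  using assms
proof (induction p arbitrary: h rule: real_polynomial_function.induct)
  case (linear p)
  have *: "h x * of_real (p (cis (2 * pi * x / r))) =
      Complex (p 1) (p \<i>) / 2 * (h x * exp (- \<i> * of_real (freq r 1 * x))) +
      Complex (p 1) (- p \<i>) / 2 * (h x * exp (- \<i> * of_real (freq r (-1) * x)))" for x
    unfolding bounded_linear_cis[OF linear(1)] by (simp add: freq_def algebra_simps)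
  show ?case
    unfolding * using linear(2,3)
    by (intro conjI allI)
       (auto simp only: fourier_coeff_add fourier_coeff_cmult fourier_coeff_mult_exp
          integrable_mult_exp integrable_mult_right Bochner_Integration.integrable_add
          mult_zero_right add_0)
next
  case (const c)
  then show ?case
    using fourier_coeff_cmult[of r "of_real c" h] by (simp add: mult.commute)
next
  case (add p q)
  then show ?case
    by (simp add: distrib_left fourier_coeff_add)
next
  case (mult p q)
  from mult.IH(2)[of "\<lambda>x. h x * of_real (p (cis (2 * pi * x / r)))"] mult.IH(1)[of h] mult.prems
  show ?case
    by (simp add: mult.assoc)
qed

text \<open>Polynomials restricted to the circle are trigonometric polynomials, to which
  \<open>h\<close> is already orthogonal. Stone-Weierstrass approximates \<phi> uniformly within
  \<open>e\<close>, and the error is at most \<open>e\<close> times the L1 norm of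
  \<open>h\<close>.\<close>

lemma continuous_on_circle_orthogonal:
  assumes h: "integrable (lebesgue_on {0..r}) h" "\<And>k. fourier_coeff r h k = 0" and "r > 0"
    and \<phi>: "continuous_on (sphere 0 1) (\<phi> :: complex \<Rightarrow> real)"
  shows "(\<integral>x. h x * of_real (\<phi> (cis (2 * pi * x / r))) \<partial>lebesgue_on {0..r}) = 0"
proof -
  let ?M = "lebesgue_on {0..r}"
  let ?c = "\<lambda>x. cis (2 * pi * x / r)"
  obtain B where B: "\<And>z. z \<in> sphere 0 1 \<Longrightarrow> norm (\<phi> z) \<le> B"
    using compact_imp_bounded[OF compact_continuous_image[OF \<phi> compact_sphere]]
    unfolding bounded_iff by blast
  have sph: "?c x \<in> sphere 0 1" for x by simp
  have "continuous_on UNIV (\<lambda>x. complex_of_real (\<phi> (?c x)))"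
    by (intro continuous_intros continuous_on_compose2[OF \<phi>]) (use \<open>r > 0\<close> in auto)
  then have int\<phi>: "integrable ?M (\<lambda>x. h x * of_real (\<phi> (?c x)))"
    using B[OF sph] by (intro integrable_mult_bounded_torus[OF h(1), of _ B] continuous_on_imp_measurable_torus) auto
  have "norm (\<integral>x. h x * of_real (\<phi> (?c x)) \<partial>?M) \<le> e * (\<integral>x. norm (h x) \<partial>?M)" if "e > 0" for e
  proof -
    obtain p where p: "real_polynomial_function p" "\<And>z. z \<in> sphere 0 1 \<Longrightarrow> \<bar>\<phi> z - p z\<bar> < e"
      using Stone_Weierstrass_real_polynomial_function[OF compact_sphere \<phi> \<open>e > 0\<close>] by blast
    note q = real_polynomial_function_orthogonal[OF p(1) h]
    \<comment> \<open>The coefficient at frequency 0 is the mean value, so its vanishing is the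
      vanishing of the integral.\<close>
    have "fourier_coeff r (\<lambda>x. h x * of_real (p (?c x))) 0 = 0" using q by blast
    then have 0: "(\<integral>x. h x * of_real (p (?c x)) \<partial>?M) = 0"
      using \<open>r > 0\<close> by (simp add: fourier_coeff_def freq_def)
    have "norm (\<integral>x. h x * of_real (\<phi> (?c x)) \<partial>?M)
        = norm (\<integral>x. h x * of_real (\<phi> (?c x)) - h x * of_real (p (?c x)) \<partial>?M)"
      using int\<phi> q 0 by simp
    also have "\<dots> \<le> (\<integral>x. norm (h x * of_real (\<phi> (?c x)) - h x * of_real (p (?c x))) \<partial>?M)"
      by (rule integral_norm_bound)
    also have "\<dots> \<le> (\<integral>x. e * norm (h x) \<partial>?M)"
    proof (rule integral_mono)
      show "integrable ?M (\<lambda>x. norm (h x * of_real (\<phi> (?c x)) - h x * of_real (p (?c x))))"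
        using int\<phi> q by auto
      show "integrable ?M (\<lambda>x. e * norm (h x))" using h by simp
      fix x
      have "norm (h x * of_real (\<phi> (?c x)) - h x * of_real (p (?c x))) = norm (h x) * \<bar>\<phi> (?c x) - p (?c x)\<bar>"
        by (simp flip: right_diff_distrib of_real_diff add: norm_mult)
      also have "\<dots> \<le> norm (h x) * e"
        using p(2)[OF sph, of x] by (intro mult_left_mono) auto
      finally show "norm (h x * of_real (\<phi> (?c x)) - h x * of_real (p (?c x))) \<le> e * norm (h x)"
        by (simp add: mult.commute)
    qed
    finally show ?thesis by simp
  qed
  then have "norm (\<integral>x. h x * of_real (\<phi> (?c x)) \<partial>?M) \<le> 0"
    by (intro tendsto_lowerbound[where F="at_right 0" and f="\<lambda>e. e * (\<integral>x. norm (h x) \<partial>?M)"])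
       (auto intro!: tendsto_eq_intros eventually_mono[OF eventually_at_right_less])
  then show ?thesis by simp
qed

text \<open>The indicator of the image of S on the circle is a pointwise limit of continuous
  functions bounded by 1. Wrapping [0,r] around the circle identifies only the endpoints, which form
  a null set.\<close>

lemma integral_closed_eq_0:
  assumes h: "integrable (lebesgue_on {0..r}) h" "\<And>k. fourier_coeff r h k = 0" and "r > 0"
    and S: "closed S" "S \<subseteq> {0..r}"
  shows "(\<integral>x. indicator S x *\<^sub>R h x \<partial>lebesgue_on {0..r}) = 0"
\<comment> \<open>\<open>infdist\<close> to the empty set is 0, so the approximants below would be
  constantly 1 there instead of tending to the indicator.\<close>
proof (cases "S = {}")
  case False
  let ?M = "lebesgue_on {0..r}"
  let ?c = "\<lambda>x. cis (2 * pi * x / r)"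
  define K where "K = ?c ` S"
  have "compact S"
    using S by (meson bounded_closed_interval bounded_subset compact_eq_bounded_closed)
  then have "compact K"
    unfolding K_def by (intro compact_continuous_image continuous_intros) (use \<open>r > 0\<close> in auto)
  then have K: "closed K" "K \<noteq> {}"
    using False by (auto simp: compact_imp_closed K_def)
  \<comment> \<open>These tents equal 1 on K and vanish at distance 1/n or more. Off the closed set
    K the distance is positive, so they are eventually 0.\<close>
  define \<phi> where "\<phi> n z = max 0 (1 - real n * infdist z K)" for n z
  have cont: "continuous_on A (\<phi> n)" for n A
    unfolding \<phi>_def by (intro continuous_intros)
  have \<phi>01: "0 \<le> \<phi> n z" "\<phi> n z \<le> 1" for n z
    by (auto simp: \<phi>_def infdist_nonneg)
  have lim: "(\<lambda>n. \<phi> n z) \<longlonglongrightarrow> indicator K z" for z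
  proof (cases "z \<in> K")
    case True
    then show ?thesis by (simp add: \<phi>_def)
  next
    case False
    then have pos: "infdist z K > 0"
      using K in_closed_iff_infdist_zero[of K z] infdist_nonneg[of z K] by auto
    then obtain N where N: "1 < real N * infdist z K"
      using reals_Archimedean3 by blast
    have "\<phi> n z = 0" if "n \<ge> N" for n
    proof -
      have "real N * infdist z K \<le> real n * infdist z K"
        using that pos by simp
      then show ?thesis using N by (simp add: \<phi>_def)
    qed
    then have "eventually (\<lambda>n. \<phi> n z = 0) sequentially"
      using eventually_sequentially by blast
    then show ?thesis using False by (simp add: tendsto_eventually)
  qed
  have [measurable]: "h \<in> borel_measurable ?M" using h by auto
  have [measurable]: "(\<lambda>x. complex_of_real (\<phi> n (?c x))) \<in> borel_measurable ?M" for n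
    by (intro continuous_on_imp_measurable_torus continuous_intros continuous_on_compose2[OF cont[of UNIV]])
       (use \<open>r > 0\<close> in auto)
  have [measurable]: "{0..r} \<inter> S \<in> sets lebesgue" using S by auto
  \<comment> \<open>Equal points on the circle have parameters differing by n periods. As x is
    interior and y lies in [0,r], the difference is strictly between -r and r, which forces n =
    0.\<close>
  have S_iff: "?c x \<in> K \<longleftrightarrow> x \<in> S" if x: "0 < x" "x < r" for x
  proof
    assume "?c x \<in> K"
    then obtain y where y: "y \<in> S" "?c x = ?c y" by (auto simp: K_def)
    from y(2) have "cos (2 * pi * x / r - 2 * pi * y / r) = 1"
      by (simp add: complex_eq_iff cos_diff flip: power2_eq_square)
    then obtain n where n: "2 * pi * x / r - 2 * pi * y / r = of_int n * 2 * pi"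
      using cos_one_2pi_int by blast
    have "2 * pi / r * (x - y) = 2 * pi / r * (of_int n * r)"
      using n \<open>r > 0\<close> by (simp add: field_simps)
    moreover have "2 * pi / r \<noteq> 0" using \<open>r > 0\<close> by simp
    ultimately have "x - y = of_int n * r"
      using mult_left_cancel by blast
    moreover have "0 \<le> y" "y \<le> r" using y S by auto
    ultimately have "of_int n * r < 1 * r" "(-1) * r < of_int n * r" using x by linarith+
    then have "of_int n < (1::real)" "(-1::real) < of_int n"
      using \<open>r > 0\<close> by (simp_all only: mult_less_cancel_right_pos)
    then have "n = 0" by linarith
    with \<open>x - y = of_int n * r\<close> y show "x \<in> S" by simp
  qed (simp add: K_def)
  have "(\<lambda>n. \<integral>x. h x * of_real (\<phi> n (?c x)) \<partial>?M) \<longlonglongrightarrow> (\<integral>x. indicator S x *\<^sub>R h x \<partial>?M)"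
  proof (rule integral_dominated_convergence)
    show "integrable ?M (\<lambda>x. norm (h x))" using h by auto
    show "(\<lambda>x. indicat_real S x *\<^sub>R h x) \<in> borel_measurable ?M"
      using S by (intro borel_measurable_scaleR borel_measurable_indicator) (auto simp: sets_restrict_space)
    have "AE x in ?M. x \<notin> {0, r}"
      by (rule AE_not_in) (use \<open>r > 0\<close> in \<open>auto simp: null_sets_restrict_space\<close>)
    moreover have "AE x in ?M. x \<in> {0..r}"
      by (rule AE_I2) auto
    ultimately show "AE x in ?M. (\<lambda>n. h x * of_real (\<phi> n (?c x))) \<longlonglongrightarrow> indicator S x *\<^sub>R h x"
    proof eventually_elim
      case (elim x)
      then have "indicator K (?c x) = (indicator S x :: real)"
        using S_iff[of x] by (auto simp: indicator_def)
      with lim[of "?c x"] have "(\<lambda>n. complex_of_real (\<phi> n (?c x))) \<longlonglongrightarrow> of_real (indicator S x)"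
        by (intro tendsto_of_real) simp
      from tendsto_mult[OF tendsto_const[of "h x"] this] show ?case
        by (simp add: scaleR_conv_of_real mult.commute)
    qed
    show "AE x in ?M. norm (h x * of_real (\<phi> n (?c x))) \<le> norm (h x)" for n
      using \<phi>01 by (auto intro!: AE_I2 simp: norm_mult mult_left_le)
  qed measurable
  moreover have "(\<integral>x. h x * of_real (\<phi> n (?c x)) \<partial>?M) = 0" for n
    by (rule continuous_on_circle_orthogonal[OF h \<open>r > 0\<close> cont])
  ultimately show ?thesis
    by (simp add: LIMSEQ_const_iff)
qed simp

text \<open>Up to a null set, a measurable set is a countable union of compact sets. Their finite
  unions are closed and increasing, so dominated convergence carries the closed case over.\<close>

lemma integral_measurable_eq_0:
  assumes h: "integrable (lebesgue_on {0..r}) h" "\<And>k. fourier_coeff r h k = 0" and "r > 0"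
    and A: "A \<in> sets (lebesgue_on {0..r})"
  shows "(\<integral>x. indicator A x *\<^sub>R h x \<partial>lebesgue_on {0..r}) = 0"
proof -
  let ?M = "lebesgue_on {0..r}"
  have [measurable]: "h \<in> borel_measurable ?M" using h by auto
  have A': "A \<in> sets lebesgue" "A \<subseteq> {0..r}"
    using A by (auto simp: sets_restrict_space_iff)
  obtain C T where C: "fsigma C" "T \<in> null_sets lebesgue" "C \<union> T = A" "disjnt C T"
    using lebesgue_set_almost_fsigma[OF A'(1)] .
  obtain F :: "nat \<Rightarrow> real set" where F: "range F \<subseteq> Collect compact" "C = \<Union> (range F)"
    using fsigma_Union_compact C(1) by metis
  define G where "G n = (\<Union>i\<le>n. F i)" for n
  have cl: "closed (G n)" for n
  proof -
    have "compact (F i)" for i using F(1) by blast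
    then show ?thesis unfolding G_def by (intro closed_UN) (auto simp: compact_imp_closed)
  qed
  have sub: "G n \<subseteq> {0..r}" for n
    using A' C F unfolding G_def by blast
  have meas: "G n \<in> sets ?M" for n
    using cl[of n] sub[of n] by (auto simp: sets_restrict_space_iff)
  have "(\<lambda>n. \<integral>x. indicator (G n) x *\<^sub>R h x \<partial>?M) \<longlonglongrightarrow> (\<integral>x. indicator A x *\<^sub>R h x \<partial>?M)"
  proof (rule integral_dominated_convergence)
    show "integrable ?M (\<lambda>x. norm (h x))" using h by auto
    show "(\<lambda>x. indicat_real A x *\<^sub>R h x) \<in> borel_measurable ?M"
      using A by measurable
    show "(\<lambda>x. indicat_real (G n) x *\<^sub>R h x) \<in> borel_measurable ?M" for n
      using meas[of n] by measurable
    have "T \<subseteq> {0..r}" using C A' by auto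
    then have "AE x in ?M. x \<notin> T"
      using C(2) by (intro AE_not_in) (auto simp: null_sets_restrict_space)
    then show "AE x in ?M. (\<lambda>n. indicat_real (G n) x *\<^sub>R h x) \<longlonglongrightarrow> indicator A x *\<^sub>R h x"
    proof eventually_elim
      case (elim x)
      have "incseq G" unfolding G_def by (force simp: incseq_def)
      moreover have "(\<Union>i. G i) = C" unfolding G_def F(2) by blast
      ultimately have "(\<lambda>n. indicat_real (G n) x) \<longlonglongrightarrow> indicator C x"
        using LIMSEQ_indicator_incseq[of G x] by simp
      moreover have "indicat_real C x = indicator A x"
        using elim C(3) by (auto simp: indicator_def)
      ultimately show ?case by (auto intro!: tendsto_intros)
    qed
    show "AE x in ?M. norm (indicat_real (G n) x *\<^sub>R h x) \<le> norm (h x)" for n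
      by (auto simp: indicator_def)
  qed
  moreover have "(\<integral>x. indicator (G n) x *\<^sub>R h x \<partial>?M) = 0" for n
    by (rule integral_closed_eq_0[OF h \<open>r > 0\<close> cl sub])
  ultimately show ?thesis
    by (simp add: LIMSEQ_const_iff)
qed

text \<open>On the set where g > 0 the integrand is nonnegative but its integral is not positive, so
  that set is null. The one-sided form is what the real and imaginary parts, with both signs, are
  fed into.\<close>

lemma AE_zero_if_set_integrals_nonpos:
  fixes g :: "'a \<Rightarrow> real"
  assumes g: "integrable M g"
    and "\<And>A. A \<in> sets M \<Longrightarrow> (\<integral>x. indicator A x *\<^sub>R g x \<partial>M) \<le> 0"
  shows "AE x in M. g x \<le> 0"
proof -
  have [measurable]: "g \<in> borel_measurable M" using g by auto
  define A where "A = {x \<in> space M. g x > 0}"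
  have A: "A \<in> sets M" unfolding A_def by measurable
  have nonneg: "0 \<le> indicator A x *\<^sub>R g x" for x
    by (auto simp: A_def indicator_def)
  have int: "integrable M (\<lambda>x. indicator A x *\<^sub>R g x)"
    using A g by (rule integrable_mult_indicator)
  have "(\<integral>x. indicator A x *\<^sub>R g x \<partial>M) = 0"
    using assms(2)[OF A] Bochner_Integration.integral_nonneg[OF nonneg, of M] by (intro antisym) auto
  then have "AE x in M. indicator A x *\<^sub>R g x = 0"
    using integral_nonneg_eq_0_iff_AE[OF int] nonneg by auto
  then show ?thesis
    using AE_space by eventually_elim (auto simp: A_def indicator_def split: if_splits)
qed

theorem fourier_coeff_eq_0_imp_AE_eq_0:
  assumes h: "integrable (lebesgue_on {0..r}) h" "\<And>k. fourier_coeff r h k = 0" and "r > 0"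
  shows "AE x in lebesgue_on {0..r}. h x = 0"
proof -
  let ?M = "lebesgue_on {0..r}"
  note 0 = integral_measurable_eq_0[OF h \<open>r > 0\<close>]
  \<comment> \<open>Real-linear functionals commute with the integral. The four choices Re, -Re, Im
    and -Im together force \<open>h\<close> to vanish.\<close>
  have *: "AE x in ?M. f (h x) \<le> 0" if f: "bounded_linear f" for f :: "complex \<Rightarrow> real"
  proof (rule AE_zero_if_set_integrals_nonpos)
    interpret f: bounded_linear f by fact
    show "integrable ?M (\<lambda>x. f (h x))"
      using h(1) by (rule integrable_bounded_linear[OF f])
    fix A assume A: "A \<in> sets ?M"
    have "(\<integral>x. indicator A x *\<^sub>R f (h x) \<partial>?M) = (\<integral>x. f (indicator A x *\<^sub>R h x) \<partial>?M)"
      by (simp only: f.scaleR)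
    also have "\<dots> = f (\<integral>x. indicator A x *\<^sub>R h x \<partial>?M)"
      using integrable_mult_indicator[OF A h(1)] by (rule integral_bounded_linear[OF f])
    finally show "(\<integral>x. indicator A x *\<^sub>R f (h x) \<partial>?M) \<le> 0"
      using 0[OF A] f.zero by simp
  qed
  have "AE x in ?M. Re (h x) \<le> 0" "AE x in ?M. - Re (h x) \<le> 0"
    "AE x in ?M. Im (h x) \<le> 0" "AE x in ?M. - Im (h x) \<le> 0"
    by (intro *; intro bounded_linear_minus bounded_linear_Re bounded_linear_Im)+
  then show ?thesis
    by eventually_elim (simp add: complex_eq_iff)
qed

section \<open>Convolution with an integrable kernel\<close>

lemma integrable_bounded_torus:
  fixes g :: "real \<Rightarrow> complex"
  assumes "g \<in> borel_measurable borel" and B: "\<And>x. norm (g x) \<le> B"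
  shows "integrable (lebesgue_on {0..r}) g"
proof (rule Bochner_Integration.integrable_bound[of _ "\<lambda>_. B"])
  have "g \<in> borel_measurable lebesgue"
    using assms(1) by (intro measurable_completion) simp
  then show "g \<in> borel_measurable (lebesgue_on {0..r})"
    by (rule measurable_restrict_space1)
  show "integrable (lebesgue_on {0..r}) (\<lambda>_. B)"
    by (simp add: integrable_restrict_space set_integrable_def)
  show "AE x in lebesgue_on {0..r}. norm (g x) \<le> norm B"
    using B by (intro AE_I2) (metis abs_ge_self order_trans real_norm_def)
qed

text \<open>Passing from \<open>lebesgue_on\<close> to \<open>lborel\<close> prepares for Fubini,
  which is applied to the product of two Borel-Lebesgue measures.\<close>

lemma fourier_coeff_lborel:
  assumes [measurable]: "g \<in> borel_measurable borel"
  shows "fourier_coeff r g k =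
     (1 / of_real r) * (\<integral>x. indicator {0..r} x *\<^sub>R (g x * exp (- \<i> * of_real (freq r k * x))) \<partial>lborel)"
proof -
  have "(\<lambda>x. exp (- \<i> * of_real (freq r k * x))) \<in> borel_measurable borel"
    by (intro borel_measurable_continuous_onI continuous_intros)
  then have [measurable]: "(\<lambda>x. indicator {0..r} x *\<^sub>R (g x * exp (- \<i> * of_real (freq r k * x)))) \<in> borel_measurable lborel"
    by measurable
  show ?thesis
    unfolding fourier_coeff_def
    by (subst integral_restrict_space) (auto simp: integral_completion)
qed

text \<open>The kernel lives on the whole line and only \<open>g\<close> will be periodic. A kernel
  whose support is longer than a period therefore requires no folding.\<close>

definition convolution :: "(real \<Rightarrow> real) \<Rightarrow> (real \<Rightarrow> complex) \<Rightarrow> real \<Rightarrow> complex" where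
  "convolution K g x = (\<integral>z. K z *\<^sub>R g (x - z) \<partial>lborel)"

context
  fixes K :: "real \<Rightarrow> real" and g :: "real \<Rightarrow> complex" and B :: real
  assumes K: "integrable lborel K"
    and g[measurable]: "g \<in> borel_measurable borel" and B: "\<And>x. norm (g x) \<le> B"
begin

private lemma measurable_integrand: "(\<lambda>z. K z *\<^sub>R g (x - z)) \<in> borel_measurable borel"
proof -
  have [measurable]: "K \<in> borel_measurable borel"
    using borel_measurable_integrable[OF K] by simp
  show ?thesis by measurable
qed

private lemma norm_convolution_integrand: "norm (K z *\<^sub>R g y) \<le> B * \<bar>K z\<bar>"
  using mult_right_mono[OF B[of y], of "\<bar>K z\<bar>"] by (simp add: mult.commute)

lemma integrable_convolution: "integrable lborel (\<lambda>z. K z *\<^sub>R g (x - z))"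
proof (rule Bochner_Integration.integrable_bound)
  show "integrable lborel (\<lambda>z. B * \<bar>K z\<bar>)" using K by simp
  show "AE z in lborel. norm (K z *\<^sub>R g (x - z)) \<le> norm (B * \<bar>K z\<bar>)"
    using norm_convolution_integrand by (intro AE_I2) (metis abs_ge_self order_trans real_norm_def)
qed (simp add: measurable_integrand)

lemma norm_convolution_le: "norm (convolution K g x) \<le> (\<integral>z. \<bar>K z\<bar> \<partial>lborel) * B"
proof -
  have "norm (convolution K g x) \<le> (\<integral>z. norm (K z *\<^sub>R g (x - z)) \<partial>lborel)"
    unfolding convolution_def by (rule integral_norm_bound)
  also have "\<dots> \<le> (\<integral>z. B * \<bar>K z\<bar> \<partial>lborel)"
    by (intro integral_mono integrable_norm[OF integrable_convolution] norm_convolution_integrand)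
       (use K in simp)
  finally show ?thesis by (simp add: mult.commute)
qed

text \<open>
  Since \<open>g\<close> is continuous off a countable set, dominated convergence replaces the continuity
  of translations in $L^1$.
\<close>

lemma continuous_convolution:
  assumes D: "countable D" "\<And>x. x \<notin> D \<Longrightarrow> isCont g x"
  shows "continuous_on UNIV (convolution K g)"
  unfolding continuous_on_sequentially
proof safe
  fix X :: "nat \<Rightarrow> real" and a assume X: "X \<longlonglongrightarrow> a"
  show "(convolution K g \<circ> X) \<longlonglongrightarrow> convolution K g a"
    unfolding convolution_def o_def
  proof (rule integral_dominated_convergence)
    show "integrable lborel (\<lambda>z. B * \<bar>K z\<bar>)" using K by simp
    \<comment> \<open>Convergence can fail only where a - z is a discontinuity of \<open>g\<close>,
      that is, on a reflected translate of D.\<close>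
    have "countable ((\<lambda>d. a - d) ` D)" using D(1) by simp
    then have "AE z in lborel. z \<notin> (\<lambda>d. a - d) ` D"
      by (intro AE_not_in countable_imp_null_set_lborel)
    then show "AE z in lborel. (\<lambda>n. K z *\<^sub>R g (X n - z)) \<longlonglongrightarrow> K z *\<^sub>R g (a - z)"
    proof eventually_elim
      case (elim z)
      then have "a - z \<notin> D" by (force simp: image_iff)
      then have "isCont g (a - z)" by (rule D(2))
      then show ?case
        using X by (intro tendsto_intros isCont_tendsto_compose[of _ g])
    qed
  qed (use norm_convolution_integrand measurable_integrand in auto)
qed

end

lemma diff_floor_mult_bounds:
  fixes r x :: real
  assumes "r > 0"
  shows "0 \<le> x - of_int \<lfloor>x / r\<rfloor> * r" "x - of_int \<lfloor>x / r\<rfloor> * r < r"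
proof -
  have "of_int \<lfloor>x / r\<rfloor> * r \<le> x"
    using assms by (simp flip: pos_le_divide_eq)
  then show "0 \<le> x - of_int \<lfloor>x / r\<rfloor> * r" by simp
  have "x < (of_int \<lfloor>x / r\<rfloor> + 1) * r"
    using assms by (simp flip: pos_divide_less_eq)
  then show "x - of_int \<lfloor>x / r\<rfloor> * r < r" by (simp add: distrib_right)
qed

lemma integrable_indicator_Icc: "integrable lborel (indicat_real {a..b :: real})"
  by (intro integrable_real_indicator) (auto simp: emeasure_lborel_Icc_eq)

text \<open>Reduce the shift modulo r to s in [0,r). Cut the window [-s, r - s] at 0 and move its
  left piece forward by one period.\<close>

lemma integral_periodic_shift:
  fixes g :: "real \<Rightarrow> complex"
  assumes [measurable]: "g \<in> borel_measurable borel" and B: "\<And>x. norm (g x) \<le> B"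
    and per: "\<And>x. g (x + r) = g x" and "r > 0"
  shows "(\<integral>x. indicator {0..r} x *\<^sub>R g (x - z) \<partial>lborel) = (\<integral>x. indicator {0..r} x *\<^sub>R g x \<partial>lborel)"
proof -
  interpret periodic_fun_simple g r by standard (rule per)
  have ae_shift: "AE x in lborel. x \<notin> {c} " for c :: real
    by (intro AE_not_in countable_imp_null_set_lborel) simp
  define n where "n = \<lfloor>z / r\<rfloor>"
  define s where "s = z - of_int n * r"
  have s: "0 \<le> s" "s < r"
    using diff_floor_mult_bounds[OF \<open>r > 0\<close>, of z] by (auto simp: s_def n_def)
  have int: "integrable lborel (\<lambda>x. indicator {a..b} x *\<^sub>R g x)" for a b
  proof (rule Bochner_Integration.integrable_bound[of _ "\<lambda>x. indicator {a..b} x *\<^sub>R B"])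
    show "AE x in lborel. norm (indicator {a..b} x *\<^sub>R g x) \<le> norm (indicat_real {a..b} x *\<^sub>R B)"
      using B by (intro AE_I2) (auto simp: indicator_def intro: order_trans[OF _ abs_ge_self])
  qed (auto simp: integrable_indicator_Icc)
  have shift: "(\<integral>x. indicator {a..b} x *\<^sub>R g x \<partial>lborel) = (\<integral>x. indicator {a+c..b+c} x *\<^sub>R g (x - c) \<partial>lborel)" for a b c
    by (subst lborel_integral_real_affine[of 1 _ "-c"]) (auto simp: indicator_def algebra_simps intro!: Bochner_Integration.integral_cong)
  have split: "(\<integral>x. indicator {a..c} x *\<^sub>R g x \<partial>lborel)
      = (\<integral>x. indicator {a..b} x *\<^sub>R g x \<partial>lborel) + (\<integral>x. indicator {b..c} x *\<^sub>R g x \<partial>lborel)"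
    if "a \<le> b" "b \<le> c" for a b c
  proof -
    \<comment> \<open>The closed intervals share the point b, so the indicators add up only off a
      null set.\<close>
    have "(\<integral>x. indicator {a..c} x *\<^sub>R g x \<partial>lborel)
        = (\<integral>x. indicator {a..b} x *\<^sub>R g x + indicator {b..c} x *\<^sub>R g x \<partial>lborel)"
      using ae_shift[of b] that by (intro integral_cong_AE) (auto simp: indicator_def elim!: eventually_mono)
    then show ?thesis using int by simp
  qed
  have "g (x - z) = g (x - s)" for x
    using minus_of_int[of "x - s" n] by (simp add: s_def algebra_simps)
  then have "(\<integral>x. indicator {0..r} x *\<^sub>R g (x - z) \<partial>lborel) = (\<integral>x. indicator {0..r} x *\<^sub>R g (x - s) \<partial>lborel)"
    by simp
  also have "\<dots> = (\<integral>x. indicator {- s..r - s} x *\<^sub>R g x \<partial>lborel)"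
    using shift[of "-s" "r - s" s] by simp
  also have "\<dots> = (\<integral>x. indicator {- s..0} x *\<^sub>R g x \<partial>lborel) + (\<integral>x. indicator {0..r - s} x *\<^sub>R g x \<partial>lborel)"
    using s by (intro split) auto
  also have "(\<integral>x. indicator {- s..0} x *\<^sub>R g x \<partial>lborel) = (\<integral>x. indicator {r - s..r} x *\<^sub>R g x \<partial>lborel)"
    using shift[of "-s" 0 r] by (simp add: minus_1)
  also have "\<dots> + (\<integral>x. indicator {0..r - s} x *\<^sub>R g x \<partial>lborel) = (\<integral>x. indicator {0..r} x *\<^sub>R g x \<partial>lborel)"
    using split[of 0 "r - s" r] s by simp
  finally show ?thesis .
qed

lemma measurable_convolution:
  assumes "integrable lborel K" "g \<in> borel_measurable borel"
  shows "convolution K g \<in> borel_measurable borel"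
proof -
  have [measurable]: "K \<in> borel_measurable borel" "g \<in> borel_measurable borel"
    using borel_measurable_integrable[OF assms(1)] assms(2) by simp_all
  have "(\<lambda>x. \<integral>z. K z *\<^sub>R g (x - z) \<partial>lborel) \<in> borel_measurable lborel"
    by measurable
  then show ?thesis by (simp add: convolution_def[abs_def])
qed

text \<open>Writing e x = e z * e (x - z) separates the variables. After Fubini the inner integral
  over one period is independent of z by periodic translation invariance.\<close>

lemma fourier_coeff_convolution:
  fixes g :: "real \<Rightarrow> complex"
  assumes K: "integrable lborel K" and g[measurable]: "g \<in> borel_measurable borel"
    and B: "\<And>x. norm (g x) \<le> B" and per: "\<And>x. g (x + r) = g x" and "r > 0"
  shows "fourier_coeff r (convolution K g) k =
    (\<integral>z. K z *\<^sub>R exp (- \<i> * of_real (freq r k * z)) \<partial>lborel) * fourier_coeff r g k"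
proof -
  define e where "e x = exp (- \<i> * of_real (freq r k * x))" for x
  have [measurable]: "K \<in> borel_measurable borel"
    using borel_measurable_integrable[OF K] by simp
  have [measurable]: "e \<in> borel_measurable borel"
    unfolding e_def by (intro borel_measurable_continuous_onI continuous_intros)
  have norm_e: "norm (e x) = 1" for x
    by (simp add: e_def norm_exp_eq_Re)
  have e_diff: "e x = e z * e (x - z)" for x z
    by (simp add: e_def exp_add[symmetric] algebra_simps)
  have e_per: "e (x + r) = e x" for x
  proof -
    have "exp (- \<i> * of_real (freq r k * r)) = exp (2 * of_int (- k) * of_real pi * \<i>)"
      using \<open>r > 0\<close> by (simp add: freq_def algebra_simps)
    also have "\<dots> = 1"
      using exp_integer_2pi[of "of_int (- k)"] by simp
    finally show ?thesis
      by (simp add: e_def distrib_left right_diff_distrib exp_diff exp_minus)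
  qed
  let ?I = "indicator {0..r} :: real \<Rightarrow> real"
  define C where "C = (\<integral>x. ?I x *\<^sub>R (g x * e x) \<partial>lborel)"
  define F where "F x z = ?I x *\<^sub>R (K z *\<^sub>R g (x - z) * e x)" for x z
  have int_F: "integrable (lborel \<Otimes>\<^sub>M lborel) (case_prod F)"
  proof (rule Bochner_Integration.integrable_bound)
    \<comment> \<open>The bound on \<open>g\<close> yields a majorant that is a product of
      integrable functions of x and of z.\<close>
    show "integrable (lborel \<Otimes>\<^sub>M lborel) (\<lambda>(x, z). ?I x * (B * \<bar>K z\<bar>))"
    proof (rule lborel_pair.Fubini_integrable)
      have "(\<lambda>x. \<integral>z. norm (case (x, z) of (x, z) \<Rightarrow> ?I x * (B * \<bar>K z\<bar>)) \<partial>lborel)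
          = (\<lambda>x. ?I x * (\<integral>z. \<bar>B * \<bar>K z\<bar>\<bar> \<partial>lborel))"
        by (simp add: abs_mult)
      then show "integrable lborel (\<lambda>x. \<integral>z. norm (case (x, z) of (x, z) \<Rightarrow> ?I x * (B * \<bar>K z\<bar>)) \<partial>lborel)"
        by (simp only:) (intro integrable_mult_left integrable_indicator_Icc)
      show "AE x in lborel. integrable lborel (\<lambda>z. case (x, z) of (x, z) \<Rightarrow> ?I x * (B * \<bar>K z\<bar>))"
        using K by simp
    qed measurable
    show "case_prod F \<in> borel_measurable (lborel \<Otimes>\<^sub>M lborel)"
      unfolding F_def by measurable
    show "AE p in lborel \<Otimes>\<^sub>M lborel. norm (case_prod F p) \<le> norm (case p of (x, z) \<Rightarrow> ?I x * (B * \<bar>K z\<bar>))"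
    proof -
      have "norm (F x z) \<le> \<bar>?I x * (B * \<bar>K z\<bar>)\<bar>" for x z
      proof -
        have "norm (F x z) \<le> ?I x * (B * \<bar>K z\<bar>)"
          using mult_right_mono[OF B[of "x - z"], of "\<bar>K z\<bar>"]
          by (simp add: F_def norm_mult norm_e indicator_def mult.commute)
        also have "\<dots> \<le> \<bar>?I x * (B * \<bar>K z\<bar>)\<bar>" by (rule abs_ge_self)
        finally show ?thesis .
      qed
      then show ?thesis
        by (intro AE_I2) (simp only: split_beta real_norm_def)
    qed
  qed
  have inner: "(\<integral>x. F x z \<partial>lborel) = (K z *\<^sub>R e z) * C" for z
  proof -
    have "F x z = (K z *\<^sub>R e z) * (?I x *\<^sub>R (g (x - z) * e (x - z)))" for x
      by (simp add: F_def e_diff[of x z])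
    then have "(\<integral>x. F x z \<partial>lborel) = (\<integral>x. (K z *\<^sub>R e z) * (?I x *\<^sub>R (g (x - z) * e (x - z))) \<partial>lborel)"
      by simp
    also have "\<dots> = (K z *\<^sub>R e z) * (\<integral>x. ?I x *\<^sub>R (g (x - z) * e (x - z)) \<partial>lborel)"
      by (rule integral_mult_right_zero)
    also have "(\<integral>x. ?I x *\<^sub>R (g (x - z) * e (x - z)) \<partial>lborel) = C"
      unfolding C_def using B
      by (intro integral_periodic_shift[where g="\<lambda>x. g x * e x" and B=B])
         (auto simp: per e_per norm_mult norm_e \<open>r > 0\<close>)
    finally show ?thesis .
  qed
  have outer: "(\<integral>z. F x z \<partial>lborel) = ?I x *\<^sub>R (convolution K g x * e x)" for x
    unfolding F_def convolution_def by (simp only: integral_scaleR_right integral_mult_left_zero)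
  have "fourier_coeff r (convolution K g) k = (1 / of_real r) * (\<integral>x. (\<integral>z. F x z \<partial>lborel) \<partial>lborel)"
    unfolding fourier_coeff_lborel[OF measurable_convolution[OF K g]]
    by (simp only: outer e_def)
  also have "(\<integral>x. (\<integral>z. F x z \<partial>lborel) \<partial>lborel) = (\<integral>z. (\<integral>x. F x z \<partial>lborel) \<partial>lborel)"
    by (rule lborel_pair.Fubini_integral[OF int_F, symmetric])
  also have "\<dots> = (\<integral>z. K z *\<^sub>R e z \<partial>lborel) * C"
    by (simp only: inner integral_mult_left_zero)
  also have "C = of_real r * fourier_coeff r g k"
    using \<open>r > 0\<close> by (simp add: C_def fourier_coeff_lborel[OF g] e_def)
  finally show ?thesis
    using \<open>r > 0\<close> by (simp add: e_def)
qed

section \<open>Piecewise continuous periodic functions\<close>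

text \<open>Countably many translates of the exceptional null set cover all exceptions. This is
  needed because \<open>pointwise_values\<close> compares functions on the whole line, while
  uniqueness speaks of one period.\<close>

lemma AE_periodic_lebesgue:
  assumes "AE x in lebesgue_on {0..r}. P x" and per: "\<And>x. P (x + r) \<longleftrightarrow> P x" and "r > 0"
  shows "AE x in lebesgue. P (x :: real)"
proof -
  interpret periodic_fun_simple P r by standard (rule per)
  have "AE x in lebesgue. x \<in> {0..r} \<longrightarrow> P x"
    using assms(1) by (subst (asm) AE_restrict_space_iff) auto
  then obtain N where "{x \<in> space lebesgue. \<not> (x \<in> {0..r} \<longrightarrow> P x)} \<subseteq> N"
      "emeasure lebesgue N = 0" "N \<in> sets lebesgue"
    by (rule AE_E)
  then have N: "N \<in> null_sets lebesgue" "{x \<in> {0..r}. \<not> P x} \<subseteq> N"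
    by (blast, force)
  have "negligible ((+) (of_int n * r) ` N)" for n
    using N(1) by (intro negligible_translation) (simp add: negligible_iff_null_sets)
  then have "negligible (\<Union>n::int. (+) (of_int n * r) ` N)"
    by (intro negligible_countable_Union) auto
  moreover have "{x \<in> space lebesgue. \<not> P x} \<subseteq> (\<Union>n::int. (+) (of_int n * r) ` N)"
  proof
    fix x assume x: "x \<in> {x \<in> space lebesgue. \<not> P x}"
    define n where "n = \<lfloor>x / r\<rfloor>"
    have "0 \<le> x - of_int n * r" "x - of_int n * r \<le> r"
      using diff_floor_mult_bounds[OF \<open>r > 0\<close>, of x] by (auto simp: n_def)
    moreover have "\<not> P (x - of_int n * r)" using x minus_of_int[of x n] by simp
    ultimately have "x - of_int n * r \<in> N" using N(2) by auto
    then show "x \<in> (\<Union>n::int. (+) (of_int n * r) ` N)"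
      by (intro UN_I[of n]) (auto simp: image_iff intro!: bexI[of _ "x - of_int n * r"])
  qed
  ultimately show ?thesis
    using AE_I'[of _ lebesgue] by (simp only: negligible_iff_null_sets)
qed

lemma isCont_periodic:
  fixes g :: "real \<Rightarrow> 'a::topological_space"
  assumes "\<And>x. g (x + r) = g x" "isCont g (x - of_int n * r)"
  shows "isCont g x"
proof -
  interpret periodic_fun_simple g r by standard (rule assms(1))
  have "isCont (\<lambda>y. g (y - of_int n * r)) x"
    by (rule isCont_o2[where g=g and f="\<lambda>y. y - of_int n * r"])
       (intro continuous_intros, rule assms(2))
  then show ?thesis by (simp add: minus_of_int)
qed

text \<open>Countability serves twice: it makes f Borel measurable, and it provides the null
  exceptional set in the continuity of convolutions.\<close>

lemma piecewise_continuous_torus_countable_discont: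
  assumes g: "piecewise_continuous_torus r g" and "r > 0"
  shows "countable {x. \<not> isCont g x}"
proof -
  interpret periodic_fun_simple g r using g by (simp add: piecewise_continuous_torus_def)
  obtain S where S: "finite S" "\<forall>x\<in>{0..<r} - S. isCont g x"
    using g by (auto simp: piecewise_continuous_torus_def)
  have "{x. \<not> isCont g x} \<subseteq> (\<Union>n::int. (\<lambda>y. y + of_int n * r) ` S)"
  proof
    fix x assume x: "x \<in> {x. \<not> isCont g x}"
    define n where "n = \<lfloor>x / r\<rfloor>"
    have "0 \<le> x - of_int n * r" "x - of_int n * r < r"
      using diff_floor_mult_bounds[OF \<open>r > 0\<close>, of x] by (auto simp: n_def)
    moreover have "\<not> isCont g (x - of_int n * r)"
      using x isCont_periodic[where g=g and r=r and x=x and n=n, OF plus_1] by blast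
    ultimately have "x - of_int n * r \<in> S" using S(2) by auto
    then show "x \<in> (\<Union>n::int. (\<lambda>y. y + of_int n * r) ` S)"
      by (intro UN_I[of n]) (auto simp: image_iff intro!: bexI[of _ "x - of_int n * r"])
  qed
  moreover have "countable (\<Union>n::int. (\<lambda>y. y + of_int n * r) ` S)"
    using S(1) by (intro countable_UN) (auto intro: countable_finite)
  ultimately show ?thesis by (rule countable_subset)
qed

lemma piecewise_continuous_torus_one_sided:
  assumes "piecewise_continuous_torus r g" "x \<in> {0..<r}"
  obtains a b where "(g \<longlongrightarrow> a) (at_left x)" "(g \<longlongrightarrow> b) (at_right x)"
proof -
  have "(g \<longlongrightarrow> g x) (at_left x)" "(g \<longlongrightarrow> g x) (at_right x)" if "isCont g x"
    using that unfolding isCont_def filterlim_at_split by auto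
  then show thesis
    using assms that unfolding piecewise_continuous_torus_def by blast
qed

text \<open>One-sided limits give local boundedness, and compactness of a closed period makes it
  global.\<close>

lemma piecewise_continuous_torus_bounded:
  assumes g: "piecewise_continuous_torus r g" and "r > 0"
  obtains B where "\<And>x. norm (g x) \<le> B"
proof -
  interpret periodic_fun_simple g r using g by (simp add: piecewise_continuous_torus_def)
  have loc0: "\<exists>U B. open U \<and> x \<in> U \<and> (\<forall>y\<in>U. norm (g y) \<le> B)" if x: "x \<in> {0..<r}" for x
  proof -
    obtain a b where ab: "(g \<longlongrightarrow> a) (at_left x)" "(g \<longlongrightarrow> b) (at_right x)"
      by (rule piecewise_continuous_torus_one_sided[OF g x])
    have B1: "eventually (\<lambda>y. norm (g y) < norm a + 1) (at_left x)"
      using order_tendstoD(2)[OF tendsto_norm[OF ab(1)], of "norm a + 1"] by simp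
    have B2: "eventually (\<lambda>y. norm (g y) < norm b + 1) (at_right x)"
      using order_tendstoD(2)[OF tendsto_norm[OF ab(2)], of "norm b + 1"] by simp
    \<comment> \<open>The one-sided limits say nothing about the value at x itself, so it enters the
      maximum separately.\<close>
    define B where "B = max (max (norm a + 1) (norm b + 1)) (norm (g x))"
    have "eventually (\<lambda>y. norm (g y) \<le> B) (at x)"
      unfolding eventually_at_split using B1 B2 by (auto elim!: eventually_mono simp: B_def)
    then have "eventually (\<lambda>y. norm (g y) \<le> B) (nhds x)"
      by (auto simp: eventually_at_filter B_def elim!: eventually_mono)
    then show ?thesis by (auto simp: eventually_nhds)
  qed
  have loc: "\<exists>U B. open U \<and> x \<in> U \<and> (\<forall>y\<in>U. norm (g y) \<le> B)" if "x \<in> {0..r}" for x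
  proof (cases "x = r")
    \<comment> \<open>The endpoint r is outside the half-open period, so its neighbourhood is a
      translate of one of 0.\<close>
    case True
    obtain U B where U: "open U" "0 \<in> U" "\<forall>y\<in>U. norm (g y) \<le> B"
      using loc0[of 0] \<open>r > 0\<close> by auto
    have "open ((+) r ` U)" using U(1) by (rule open_translation)
    moreover have "x \<in> (+) r ` U" using U(2) True by force
    moreover have "norm (g (r + y)) = norm (g y)" for y using plus_1[of y] by (simp add: add.commute)
    then have "\<forall>y\<in>(+) r ` U. norm (g y) \<le> B" using U(3) by simp
    ultimately show ?thesis by blast
  qed (use loc0[of x] that in auto)
  then obtain U B where UB: "\<And>x. x \<in> {0..r} \<Longrightarrow> open (U x) \<and> x \<in> U x \<and> (\<forall>y\<in>U x. norm (g y) \<le> B x)"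
    by metis
  have "compact {0..r}" by simp
  moreover have "open (U x)" if "x \<in> {0..r}" for x using UB[OF that] by blast
  moreover have "{0..r} \<subseteq> (\<Union>x\<in>{0..r}. U x)" using UB by blast
  ultimately obtain C where C: "C \<subseteq> {0..r}" "finite C" "{0..r} \<subseteq> (\<Union>c\<in>C. U c)"
    by (rule compactE_image)
  define B' where "B' = Max (B ` C)"
  have "norm (g x) \<le> B'" for x
  proof -
    define y where "y = x - of_int \<lfloor>x / r\<rfloor> * r"
    have "0 \<le> y" "y \<le> r"
      using diff_floor_mult_bounds[OF \<open>r > 0\<close>, of x] by (auto simp: y_def)
    then have "y \<in> (\<Union>c\<in>C. U c)" using C(3) by (intro subsetD[OF C(3)]) simp
    then obtain c where c: "c \<in> C" "y \<in> U c" by blast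
    then have "norm (g y) \<le> B c" using UB C(1) by blast
    also have "\<dots> \<le> B'" unfolding B'_def using C(2) c by simp
    finally show ?thesis by (simp add: y_def minus_of_int)
  qed
  then show thesis by (rule that)
qed

section \<open>The kernel of the nonlocal operator\<close>

text \<open>
  At $0$ the kernel is $0$, in agreement with \<open>1 / (0 powr \<beta>) = 0\<close> in
  \<^const>\<open>nonlocal_multiplier\<close>.
\<close>

definition nonlocal_kernel :: "real \<Rightarrow> real \<Rightarrow> real \<Rightarrow> real" where
  "nonlocal_kernel \<delta> \<beta> z = nonlocal_const \<delta> \<beta> * (indicator {-\<delta>..\<delta>} z * \<bar>z\<bar> powr (- \<beta>))"

lemma measurable_nonlocal_kernel [measurable]: "nonlocal_kernel \<delta> \<beta> \<in> borel_measurable borel"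
  unfolding nonlocal_kernel_def[abs_def] by measurable

text \<open>Gamma (3/2) is half the square root of pi, which cancels against
  \<open>pi powr (1 / 2)\<close> and the factor 2.\<close>

lemma nonlocal_const_eq:
  "nonlocal_const \<delta> \<beta> = (3 - \<beta>) / \<delta> powr (3 - \<beta>)"
proof -
  have G: "Gamma (3 / 2 :: real) = sqrt pi / 2"
  proof -
    have "(1 / 2 :: real) \<notin> \<int>\<^sub>\<le>\<^sub>0"
      using nonpos_Ints_nonpos[of "1 / 2 :: real"] by auto
    then show ?thesis
      using Gamma_plus1[of "1 / 2 :: real"] by (simp add: Gamma_one_half_real)
  qed
  show ?thesis
    unfolding nonlocal_const_def G
    by (cases "\<delta> = 0") (simp_all add: powr_half_sqrt field_simps)
qed

lemma has_bochner_integral_abs_powr: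
  fixes a \<delta> :: real
  assumes "a > -1" "\<delta> \<ge> 0"
  shows "has_bochner_integral lborel (\<lambda>z. indicator {-\<delta>..\<delta>} z * \<bar>z\<bar> powr a) (2 * (\<delta> powr (a + 1) / (a + 1)))"
proof -
  define P where "P z = indicator {0..\<delta>} z *\<^sub>R (z powr a)" for z :: real
  have [measurable]: "P \<in> borel_measurable borel" unfolding P_def by measurable
  have hi: "((\<lambda>z. z powr a) has_integral (\<delta> powr (a + 1) / (a + 1))) {0..\<delta>}"
    using assms by (rule has_integral_powr_from_0)
  \<comment> \<open>The gauge integral of a nonnegative function is absolute, which gives access to
    the Lebesgue integral.\<close>
  then have abs: "(\<lambda>z. z powr a) absolutely_integrable_on {0..\<delta>}"
    by (intro nonnegative_absolutely_integrable_1) auto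
  then have 1: "integrable lborel P"
    unfolding set_integrable_def P_def[symmetric] by (simp add: integrable_completion)
  have "integral\<^sup>L lebesgue P = \<delta> powr (a + 1) / (a + 1)"
    using set_lebesgue_integral_eq_integral(2)[OF abs] integral_unique[OF hi]
    by (simp add: set_lebesgue_integral_def P_def[abs_def])
  then have P: "has_bochner_integral lborel P (\<delta> powr (a + 1) / (a + 1))"
    using 1 by (simp add: has_bochner_integral_iff integral_completion)
  then have P': "has_bochner_integral lborel (\<lambda>z. P (- z)) (\<delta> powr (a + 1) / (a + 1))"
    using lborel_has_bochner_integral_real_affine_iff[of "-1" P _ 0] by simp
  \<comment> \<open>At z = 0 both halves are present, but \<open>0 powr a = 0\<close>, so the
    identity holds there too.\<close>
  have "indicator {-\<delta>..\<delta>} z * \<bar>z\<bar> powr a = P z + P (- z)" for z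
    by (auto simp: P_def indicator_def)
  then show ?thesis
    using has_bochner_integral_add[OF P P'] by (simp add: field_simps)
qed

context
  fixes \<delta> \<beta> :: real
  assumes \<delta>: "\<delta> > 0" and \<beta>: "\<beta> < 1"
begin

lemma integrable_nonlocal_kernel: "integrable lborel (nonlocal_kernel \<delta> \<beta>)"
  and integral_nonlocal_kernel: "(\<integral>z. nonlocal_kernel \<delta> \<beta> z \<partial>lborel) = decay_rate \<delta> \<beta>"
proof -
  have "has_bochner_integral lborel (nonlocal_kernel \<delta> \<beta>)
      (nonlocal_const \<delta> \<beta> * (2 * (\<delta> powr (- \<beta> + 1) / (- \<beta> + 1))))"
    unfolding nonlocal_kernel_def[abs_def]
    using \<delta> \<beta> by (intro has_bochner_integral_mult_right has_bochner_integral_abs_powr) auto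
  moreover have "nonlocal_const \<delta> \<beta> * (2 * (\<delta> powr (- \<beta> + 1) / (- \<beta> + 1))) = decay_rate \<delta> \<beta>"
  proof -
    have "\<delta> powr (3 - \<beta>) = \<delta> powr (- \<beta> + 1) * \<delta>\<^sup>2"
      using \<delta> powr_add[of \<delta> "- \<beta> + 1" 2] by (simp add: add.commute powr_numeral)
    then show ?thesis
      using \<delta> \<beta> by (simp add: nonlocal_const_eq decay_rate_def field_simps)
  qed
  ultimately show "integrable lborel (nonlocal_kernel \<delta> \<beta>)"
    "(\<integral>z. nonlocal_kernel \<delta> \<beta> z \<partial>lborel) = decay_rate \<delta> \<beta>"
    by (simp_all add: has_bochner_integral_iff)
qed

lemma nonlocal_kernel_nonneg: "nonlocal_kernel \<delta> \<beta> z \<ge> 0"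
  using \<beta> by (simp add: nonlocal_kernel_def nonlocal_const_eq)

lemma nonlocal_kernel_minus: "nonlocal_kernel \<delta> \<beta> (- z) = nonlocal_kernel \<delta> \<beta> z"
  by (auto simp: nonlocal_kernel_def indicator_def)

private lemma integrable_kernel_mult:
  assumes [measurable]: "g \<in> borel_measurable borel" and "\<And>z. \<bar>g z\<bar> \<le> (1::real)"
  shows "integrable lborel (\<lambda>z. nonlocal_kernel \<delta> \<beta> z * g z)"
proof (rule Bochner_Integration.integrable_bound[OF integrable_nonlocal_kernel])
  show "AE z in lborel. norm (nonlocal_kernel \<delta> \<beta> z * g z) \<le> norm (nonlocal_kernel \<delta> \<beta> z)"
    using assms(2) by (intro AE_I2) (simp add: abs_mult mult_left_le)
qed measurable

text \<open>The kernel is integrable on its own, so cos - 1 may be split; the constant -1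
  contributes minus the total mass.\<close>

lemma nonlocal_multiplier_eq:
  "nonlocal_multiplier \<delta> \<beta> \<nu> + decay_rate \<delta> \<beta> = (\<integral>z. nonlocal_kernel \<delta> \<beta> z * cos (\<nu> * z) \<partial>lborel)"
proof -
  have "nonlocal_multiplier \<delta> \<beta> \<nu> =
      nonlocal_const \<delta> \<beta> * (\<integral>z. indicator {-\<delta>..\<delta>} z *\<^sub>R ((cos (\<nu> * z) - 1) / \<bar>z\<bar> powr \<beta>) \<partial>lborel)"
    unfolding nonlocal_multiplier_def
    by (subst integral_restrict_space) (auto simp: integral_completion)
  also have "\<dots> = (\<integral>z. nonlocal_const \<delta> \<beta> * (indicator {-\<delta>..\<delta>} z *\<^sub>R ((cos (\<nu> * z) - 1) / \<bar>z\<bar> powr \<beta>)) \<partial>lborel)"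
    by (rule integral_mult_right_zero[symmetric])
  also have "\<dots> = (\<integral>z. nonlocal_kernel \<delta> \<beta> z * cos (\<nu> * z) - nonlocal_kernel \<delta> \<beta> z \<partial>lborel)"
    by (intro Bochner_Integration.integral_cong refl)
       (simp add: nonlocal_kernel_def powr_minus divide_inverse algebra_simps)
  also have "\<dots> = (\<integral>z. nonlocal_kernel \<delta> \<beta> z * cos (\<nu> * z) \<partial>lborel) - decay_rate \<delta> \<beta>"
    using integrable_kernel_mult[of "\<lambda>z. cos (\<nu> * z)"] integrable_nonlocal_kernel
    by (simp add: integral_nonlocal_kernel)
  finally show ?thesis by simp
qed

lemma fourier_transform_nonlocal_kernel:
  "(\<integral>z. nonlocal_kernel \<delta> \<beta> z *\<^sub>R exp (- \<i> * of_real (\<nu> * z)) \<partial>lborel)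
    = of_real (nonlocal_multiplier \<delta> \<beta> \<nu> + decay_rate \<delta> \<beta>)"
proof -
  let ?K = "nonlocal_kernel \<delta> \<beta>"
  have ic: "integrable lborel (\<lambda>z. ?K z * cos (\<nu> * z))" and isin: "integrable lborel (\<lambda>z. ?K z * sin (\<nu> * z))"
    by (intro integrable_kernel_mult; simp)+
  \<comment> \<open>Reflection: the kernel is even and the sine odd, so the imaginary part vanishes
    and the transform is real.\<close>
  have "(\<integral>z. ?K z * sin (\<nu> * z) \<partial>lborel) = (\<integral>z. ?K (- z) * sin (\<nu> * (- z)) \<partial>lborel)"
    by (subst lborel_integral_real_affine[of "-1" _ 0]) auto
  also have "\<dots> = - (\<integral>z. ?K z * sin (\<nu> * z) \<partial>lborel)"
    by (simp add: nonlocal_kernel_minus)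
  finally have s0: "(\<integral>z. ?K z * sin (\<nu> * z) \<partial>lborel) = 0" by simp
  have "?K z *\<^sub>R exp (- \<i> * of_real (\<nu> * z)) =
      of_real (?K z * cos (\<nu> * z)) - \<i> * of_real (?K z * sin (\<nu> * z))" for z
  proof -
    have "exp (- \<i> * of_real (\<nu> * z)) = cis (- (\<nu> * z))" by (simp add: cis_conv_exp)
    then show ?thesis by (simp add: complex_eq_iff)
  qed
  then have "(\<integral>z. ?K z *\<^sub>R exp (- \<i> * of_real (\<nu> * z)) \<partial>lborel)
      = (\<integral>z. of_real (?K z * cos (\<nu> * z)) - \<i> * of_real (?K z * sin (\<nu> * z)) \<partial>lborel)"
    by (simp only:)
  also have "\<dots> = (\<integral>z. complex_of_real (?K z * cos (\<nu> * z)) \<partial>lborel)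
      - (\<integral>z. \<i> * complex_of_real (?K z * sin (\<nu> * z)) \<partial>lborel)"
    using ic isin by (intro Bochner_Integration.integral_diff integrable_mult_right) (auto simp del: of_real_mult)
  also have "\<dots> = of_real (\<integral>z. ?K z * cos (\<nu> * z) \<partial>lborel)"
    using s0 by (simp del: of_real_mult)
  finally show ?thesis by (simp only: nonlocal_multiplier_eq)
qed

end

section \<open>Exponential series of convolutions\<close>

locale convolution_iterates =
  fixes K :: "real \<Rightarrow> real" and f :: "real \<Rightarrow> complex" and r B a :: real and D :: "real set"
  assumes K: "integrable lborel K" and K_nonneg: "\<And>z. K z \<ge> 0" and a: "a = (\<integral>z. K z \<partial>lborel)"
    and f: "f \<in> borel_measurable borel" and B: "\<And>x. norm (f x) \<le> B"
    and per: "\<And>x. f (x + r) = f x" and r: "r > 0"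
    and D: "countable D" "\<And>x. x \<notin> D \<Longrightarrow> isCont f x"
begin

text \<open>Iterating on f directly avoids forming the convolution powers of K. Index 0 is f
  itself.\<close>

definition "iter n = (convolution K ^^ n) f"

lemma iter_Suc: "iter (Suc n) = convolution K (iter n)"
  by (simp add: iter_def)

text \<open>The properties are proved jointly because each convolution step uses several of them.
  Continuity is claimed only off D so that n = 0 is included.\<close>

lemma iter_props:
  "iter n \<in> borel_measurable borel \<and> (\<forall>x. norm (iter n x) \<le> a ^ n * B) \<and>
   (\<forall>x. iter n (x + r) = iter n x) \<and> (\<forall>x. x \<notin> D \<longrightarrow> isCont (iter n) x)"
proof (induction n)
  case 0
  then show ?case using f B per D by (simp add: iter_def)
next
  case (Suc n)
  have abs_K: "(\<integral>z. \<bar>K z\<bar> \<partial>lborel) = a"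
    using K_nonneg by (simp add: a)
  have "norm (iter (Suc n) x) \<le> a * (a ^ n * B)" for x
    unfolding iter_Suc abs_K[symmetric]
    by (rule norm_convolution_le[OF K]) (use Suc abs_K in auto)
  moreover have "continuous_on UNIV (iter (Suc n))"
    unfolding iter_Suc by (rule continuous_convolution[OF K _ _ D(1)]) (use Suc in auto)
  moreover have "iter (Suc n) \<in> borel_measurable borel"
    unfolding iter_Suc by (rule measurable_convolution[OF K]) (use Suc in auto)
  moreover have "iter (Suc n) (x + r) = iter (Suc n) x" for x
    using Suc by (simp add: iter_Suc convolution_def diff_add_eq[symmetric])
  ultimately show ?case
    by (simp add: continuous_on_eq_continuous_at mult.assoc)
qed

lemma iter_measurable: "iter n \<in> borel_measurable borel"
  and norm_iter_le: "norm (iter n x) \<le> a ^ n * B"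
  and iter_periodic: "iter n (x + r) = iter n x"
  using iter_props[of n] by auto

lemma continuous_iter_Suc: "continuous_on UNIV (iter (Suc n))"
  unfolding iter_Suc using iter_props[of n] by (intro continuous_convolution[OF K _ _ D(1)]) auto

lemma fourier_coeff_iter:
  assumes m: "(\<integral>z. K z *\<^sub>R exp (- \<i> * of_real (freq r k * z)) \<partial>lborel) = of_real m"
  shows "fourier_coeff r (iter n) k = of_real (m ^ n) * fourier_coeff r f k"
proof (induction n)
  case (Suc n)
  have "fourier_coeff r (iter (Suc n)) k = of_real m * fourier_coeff r (iter n) k"
    unfolding iter_Suc m[symmetric]
    by (rule fourier_coeff_convolution[OF K iter_measurable norm_iter_le iter_periodic r])
  then show ?case by (simp add: Suc mult.assoc)
qed (simp add: iter_def)

text \<open>The index is shifted by one to leave out the term of order 0, which is f itself and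
  carries the jumps.\<close>

definition exp_term :: "real \<Rightarrow> nat \<Rightarrow> real \<Rightarrow> complex" where
  "exp_term t n x = (t ^ Suc n / fact (Suc n)) *\<^sub>R iter (Suc n) x"

definition exp_conv :: "real \<Rightarrow> real \<Rightarrow> complex" where
  "exp_conv t x = (\<Sum>n. exp_term t n x)"

text \<open>A Weierstrass majorant, uniform in x; it also justifies termwise integration.\<close>

definition "bnd t n = (\<bar>t\<bar> * a) ^ Suc n / fact (Suc n) * B"

lemma norm_exp_term_le: "norm (exp_term t n x) \<le> bnd t n"
proof -
  have "norm (exp_term t n x) = \<bar>t\<bar> ^ Suc n / fact (Suc n) * norm (iter (Suc n) x)"
    unfolding exp_term_def by (simp add: power_abs abs_mult)
  also have "\<dots> \<le> \<bar>t\<bar> ^ Suc n / fact (Suc n) * (a ^ Suc n * B)"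
    by (intro mult_left_mono norm_iter_le) auto
  also have "\<dots> = bnd t n"
    unfolding bnd_def power_mult_distrib by (simp only: times_divide_eq_left mult.assoc)
  finally show ?thesis .
qed

lemma exp_sums_Suc: "(\<lambda>n. x ^ Suc n / fact (Suc n)) sums (exp x - 1 :: real)"
proof -
  have "(\<lambda>n. x ^ n / fact n) sums exp x"
    using exp_converges[of x] by (simp add: divide_inverse mult.commute)
  then show ?thesis
    using sums_Suc_iff[of "\<lambda>n. x ^ n / fact n" "exp x - 1"] by simp
qed

lemma summable_bnd: "summable (bnd t)"
  unfolding bnd_def[abs_def] by (intro summable_mult2 sums_summable[OF exp_sums_Suc])

lemma continuous_exp_conv: "continuous_on UNIV (exp_conv t)"
proof (rule uniform_limit_theorem)
  show "uniform_limit UNIV (\<lambda>n x. \<Sum>i<n. exp_term t i x) (exp_conv t) sequentially"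
    unfolding exp_conv_def[abs_def]
    by (rule Weierstrass_m_test[OF norm_exp_term_le summable_bnd])
  show "\<forall>\<^sub>F n in sequentially. continuous_on UNIV (\<lambda>x. \<Sum>i<n. exp_term t i x)"
    unfolding exp_term_def by (intro always_eventually allI continuous_intros continuous_iter_Suc)
qed simp

lemma exp_conv_periodic: "exp_conv t (x + r) = exp_conv t x"
  by (simp add: exp_conv_def exp_term_def iter_periodic)

text \<open>The integrals of the norms of the terms over a period are at most r times
  \<open>bnd\<close>. The series may thus be integrated term by term, giving the exponential series
  of t * m without its leading 1.\<close>

lemma fourier_coeff_exp_conv:
  assumes m: "(\<integral>z. K z *\<^sub>R exp (- \<i> * of_real (freq r k * z)) \<partial>lborel) = of_real m"
  shows "fourier_coeff r (exp_conv t) k = of_real (exp (t * m) - 1) * fourier_coeff r f k"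
proof -
  let ?M = "lebesgue_on {0..r}"
  define e where "e x = exp (- \<i> * of_real (freq r k * x))" for x
  have norm_e: "norm (e x) = 1" for x
    by (simp add: e_def norm_exp_eq_Re)
  have term_meas: "exp_term t n \<in> borel_measurable borel" for n
    unfolding exp_term_def[abs_def] by (intro borel_measurable_scaleR iter_measurable) auto
  have int_term: "integrable ?M (exp_term t n)" for n
    by (rule integrable_bounded_torus[OF term_meas norm_exp_term_le])
  have int_const: "integrable ?M (\<lambda>_. c)" for c :: real
    by (simp add: integrable_restrict_space set_integrable_def)
  have "(\<lambda>n. \<integral>x. exp_term t n x * e x \<partial>?M) sums (\<integral>x. (\<Sum>n. exp_term t n x * e x) \<partial>?M)"
  proof (rule sums_integral)
    show "integrable ?M (\<lambda>x. exp_term t n x * e x)" for n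
      unfolding e_def by (rule integrable_mult_exp[OF int_term])
    show "AE x in ?M. summable (\<lambda>n. norm (exp_term t n x * e x))"
      using norm_exp_term_le
      by (intro AE_I2 summable_comparison_test'[OF summable_bnd[of t], of 0]) (simp add: norm_mult norm_e)
    show "summable (\<lambda>n. \<integral>x. norm (exp_term t n x * e x) \<partial>?M)"
    proof (rule summable_comparison_test'[of _ 0])
      show "summable (\<lambda>n. bnd t n * r)" by (intro summable_mult2 summable_bnd)
      fix n
      have "norm (\<integral>x. norm (exp_term t n x * e x) \<partial>?M) = (\<integral>x. norm (exp_term t n x) \<partial>?M)"
        by (simp add: norm_mult norm_e)
      also have "\<dots> \<le> (\<integral>x. bnd t n \<partial>?M)"
        by (intro integral_mono integrable_norm int_term int_const norm_exp_term_le)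
      also have "\<dots> = bnd t n * r"
        using r by (simp add: measure_restrict_space)
      finally show "norm (\<integral>x. norm (exp_term t n x * e x) \<partial>?M) \<le> bnd t n * r" .
    qed
  qed
  moreover have "(\<Sum>n. exp_term t n x * e x) = exp_conv t x * e x" for x
    unfolding exp_conv_def
    by (rule suminf_mult2[symmetric])
       (rule summable_comparison_test'[OF summable_bnd norm_exp_term_le])
  ultimately have "(\<lambda>n. fourier_coeff r (exp_term t n) k) sums fourier_coeff r (exp_conv t) k"
    unfolding fourier_coeff_def e_def[symmetric] by (intro sums_mult) simp
  moreover have "fourier_coeff r (exp_term t n) k =
      of_real ((t * m) ^ Suc n / fact (Suc n)) * fourier_coeff r f k" for n
    unfolding exp_term_def[abs_def] scaleR_conv_of_real fourier_coeff_cmult fourier_coeff_iter[OF m]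
    by (simp add: power_mult_distrib)
  moreover have "(\<lambda>n. of_real ((t * m) ^ Suc n / fact (Suc n)) * fourier_coeff r f k) sums
      (of_real (exp (t * m) - 1) * fourier_coeff r f k)"
    by (intro sums_mult2 sums_of_real exp_sums_Suc)
  ultimately show ?thesis
    using sums_unique2 by simp
qed

end

section \<open>Jumps of the solution\<close>

text \<open>The equivalence is needed because limits of f must also be recovered from those of the
  sum, so that the sum has no additional jumps.\<close>

lemma tendsto_add_scaled_iff:
  fixes f v :: "real \<Rightarrow> complex"
  assumes "(v \<longlongrightarrow> b) F" "c \<noteq> 0"
  shows "((\<lambda>x. v x + c * f x) \<longlongrightarrow> l) F \<longleftrightarrow> (f \<longlongrightarrow> (l - b) / c) F"
proof
  assume "((\<lambda>x. v x + c * f x) \<longlongrightarrow> l) F"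
  from tendsto_divide[OF tendsto_diff[OF this assms(1)] tendsto_const assms(2)]
  show "(f \<longlongrightarrow> (l - b) / c) F" using assms(2) by simp
next
  assume "(f \<longlongrightarrow> (l - b) / c) F"
  from tendsto_add[OF assms(1) tendsto_mult[OF tendsto_const[of c] this]]
  show "((\<lambda>x. v x + c * f x) \<longlongrightarrow> l) F" using assms(2) by simp
qed

context
  fixes r :: real and f v w :: "real \<Rightarrow> complex" and c :: complex
  assumes f: "piecewise_continuous_torus r f"
    and v: "continuous_on UNIV v" "periodic_fun_simple v r" and c: "c \<noteq> 0"
    and w: "\<And>x. w x = v x + c * f x"
begin

private lemma isCont_v: "isCont v x"
  using v(1) by (simp add: continuous_on_eq_continuous_at)

private lemma v_left: "(v \<longlongrightarrow> v x) (at_left x)" and v_right: "(v \<longlongrightarrow> v x) (at_right x)"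
  using isCont_v[of x] unfolding isCont_def filterlim_at_split by auto

private lemma left_iff: "(w \<longlongrightarrow> l) (at_left x) \<longleftrightarrow> (f \<longlongrightarrow> (l - v x) / c) (at_left x)"
  unfolding w[abs_def] by (rule tendsto_add_scaled_iff[OF v_left c])

private lemma right_iff: "(w \<longlongrightarrow> l) (at_right x) \<longleftrightarrow> (f \<longlongrightarrow> (l - v x) / c) (at_right x)"
  unfolding w[abs_def] by (rule tendsto_add_scaled_iff[OF v_right c])

private lemma left_imp: "(f \<longlongrightarrow> l) (at_left x) \<Longrightarrow> (w \<longlongrightarrow> v x + c * l) (at_left x)"
  unfolding left_iff using c by simp

private lemma right_imp: "(f \<longlongrightarrow> l) (at_right x) \<Longrightarrow> (w \<longlongrightarrow> v x + c * l) (at_right x)"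
  unfolding right_iff using c by simp

lemma piecewise_continuous_torus_add_scaled: "piecewise_continuous_torus r w"
proof -
  interpret f: periodic_fun_simple f r using f by (simp add: piecewise_continuous_torus_def)
  interpret v: periodic_fun_simple v r by (rule v)
  obtain S where S: "finite S" "S \<subseteq> {0..<r}" "\<forall>x\<in>{0..<r} - S. isCont f x"
    "\<forall>x\<in>S. (\<exists>l. (f \<longlongrightarrow> l) (at_left x)) \<and> (\<exists>l. (f \<longlongrightarrow> l) (at_right x))"
    using f unfolding piecewise_continuous_torus_def by blast
  have "periodic_fun_simple w r"
    by standard (simp add: w f.plus_1 v.plus_1)
  moreover have "\<forall>x\<in>{0..<r} - S. isCont w x"
    unfolding w[abs_def] using S(3) isCont_v by (auto intro!: continuous_intros)
  moreover have "\<forall>x\<in>S. (\<exists>l. (w \<longlongrightarrow> l) (at_left x)) \<and> (\<exists>l. (w \<longlongrightarrow> l) (at_right x))"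
    using S(4) left_imp right_imp by blast
  ultimately show ?thesis
    using S(1,2) unfolding piecewise_continuous_torus_def by blast
qed

text \<open>Both one-sided limits undergo the same map l -> v x + c * l, which is injective since c
  is nonzero.\<close>

lemma jumps_add_scaled: "jumps r w = jumps r f"
proof (intro set_eqI iffI)
  fix x assume "x \<in> jumps r f"
  then obtain a b where "x \<in> {0..<r}" "(f \<longlongrightarrow> a) (at_left x)" "(f \<longlongrightarrow> b) (at_right x)" "a \<noteq> b"
    by (auto simp: jumps_def)
  moreover from this have "v x + c * a \<noteq> v x + c * b" using c by simp
  ultimately show "x \<in> jumps r w"
    unfolding jumps_def using left_imp right_imp by blast
next
  fix x assume "x \<in> jumps r w"
  then obtain a b where ab: "x \<in> {0..<r}" "(w \<longlongrightarrow> a) (at_left x)" "(w \<longlongrightarrow> b) (at_right x)" "a \<noteq> b"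
    by (auto simp: jumps_def)
  then have "(a - v x) / c \<noteq> (b - v x) / c" using c by simp
  with ab show "x \<in> jumps r f"
    unfolding jumps_def left_iff right_iff by blast
qed

lemma jump_magnitude_add_scaled:
  assumes "x \<in> jumps r f"
  shows "jump_magnitude w x = norm c * jump_magnitude f x"
proof -
  obtain a b where ab: "(f \<longlongrightarrow> a) (at_left x)" "(f \<longlongrightarrow> b) (at_right x)"
    using assms by (auto simp: jumps_def)
  have "jump_magnitude w x = norm ((v x + c * b) - (v x + c * a))"
    unfolding jump_magnitude_def
    by (simp only: tendsto_Lim[OF trivial_limit_at_left_real left_imp[OF ab(1)]]
        tendsto_Lim[OF trivial_limit_at_right_real right_imp[OF ab(2)]])
  also have "\<dots> = norm c * norm (b - a)"
    by (simp flip: norm_mult add: right_diff_distrib)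
  also have "norm (b - a) = jump_magnitude f x"
    unfolding jump_magnitude_def
    by (simp only: tendsto_Lim[OF trivial_limit_at_left_real ab(1)]
        tendsto_Lim[OF trivial_limit_at_right_real ab(2)])
  finally show ?thesis .
qed

end

lemma jump_magnitude_pos:
  assumes "x \<in> jumps r f"
  shows "jump_magnitude f x > 0"
proof -
  obtain a b where ab: "(f \<longlongrightarrow> a) (at_left x)" "(f \<longlongrightarrow> b) (at_right x)" "a \<noteq> b"
    using assms by (auto simp: jumps_def)
  then show ?thesis
    unfolding jump_magnitude_def
    by (simp add: tendsto_Lim[OF trivial_limit_at_left_real ab(1)]
        tendsto_Lim[OF trivial_limit_at_right_real ab(2)])
qed

section \<open>Identification of the smooth part\<close>

lemma square_integrable_torus_imp_integrable:
  assumes "square_integrable_torus r g"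
  shows "integrable (lebesgue_on {0..r}) g"
proof (rule Bochner_Integration.integrable_bound)
  have "integrable (lebesgue_on {0..r}) (\<lambda>_. 1 :: real)"
    by (simp add: integrable_restrict_space set_integrable_def)
  then show "integrable (lebesgue_on {0..r}) (\<lambda>x. 1 + (norm (g x))\<^sup>2)"
    using assms unfolding square_integrable_torus_def by simp
  show "g \<in> borel_measurable (lebesgue_on {0..r})"
    using assms by (simp add: square_integrable_torus_def)
  show "AE x in lebesgue_on {0..r}. norm (g x) \<le> norm (1 + (norm (g x))\<^sup>2)"
  proof (rule AE_I2)
    fix x
    \<comment> \<open>Expanding the square gives even 2|g| at most 1 + |g|^2.\<close>
    have "0 \<le> (norm (g x) - 1)\<^sup>2" "0 \<le> (norm (g x))\<^sup>2" by simp_all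
    then have "norm (g x) \<le> 1 + (norm (g x))\<^sup>2"
      using norm_ge_zero[of "g x"] unfolding power2_diff by (simp only: power_one)
    then show "norm (g x) \<le> norm (1 + (norm (g x))\<^sup>2)" by simp
  qed
qed

text \<open>Provides the witness that triggers the implication in \<open>pointwise_values\<close>,
  which then makes \<open>v\<close> itself continuous and not only almost everywhere equal to a
  continuous function.\<close>

lemma smooth_part_continuous_representative:
  assumes "r > 0" "\<delta> > 0" "\<beta> < 1" and pc: "piecewise_continuous_torus r f"
    and v: "square_integrable_torus r v"
    and coeff: "\<And>k. fourier_coeff r v k =
           fourier_coeff r f k *
           of_real ((1 - exp (- (nonlocal_multiplier \<delta> \<beta> (freq r k) + decay_rate \<delta> \<beta>) * t)) *
                    exp (nonlocal_multiplier \<delta> \<beta> (freq r k) * t))"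
  shows "\<exists>g. periodic_fun_simple g r \<and> continuous_on UNIV g \<and> (AE x in lebesgue. g x = v x)"
proof -
  interpret f: periodic_fun_simple f r using pc by (simp add: piecewise_continuous_torus_def)
  interpret v: periodic_fun_simple v r using v by (simp add: square_integrable_torus_def)
  let ?D = "{x. \<not> isCont f x}"
  have D: "countable ?D"
    by (rule piecewise_continuous_torus_countable_discont[OF pc \<open>r > 0\<close>])
  have f_meas: "f \<in> borel_measurable borel"
    by (rule borel_measurable_continuous_countable_exceptions[OF D])
       (auto intro!: continuous_at_imp_continuous_on)
  obtain B where B: "\<And>x. norm (f x) \<le> B"
    by (rule piecewise_continuous_torus_bounded[OF pc \<open>r > 0\<close>]) blast
  interpret convolution_iterates "nonlocal_kernel \<delta> \<beta>" f r B "decay_rate \<delta> \<beta>" ?D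
    by standard
       (use assms(1-3) D f_meas B in \<open>auto simp: integrable_nonlocal_kernel integral_nonlocal_kernel
          nonlocal_kernel_nonneg f.plus_1\<close>)
  let ?a = "decay_rate \<delta> \<beta>"
  \<comment> \<open>The factor exp (- \<alpha> t) omitted from \<open>exp_conv\<close> is restored
    here.\<close>
  define g where "g x = of_real (exp (- ?a * t)) * exp_conv t x" for x
  have cont: "continuous_on UNIV g"
    unfolding g_def by (intro continuous_intros continuous_exp_conv)
  have per: "g (x + r) = g x" for x
    by (simp add: g_def exp_conv_periodic)
  have int_exp: "integrable (lebesgue_on {0..r}) (exp_conv t)"
  proof (rule integrable_bounded_torus)
    show "exp_conv t \<in> borel_measurable borel"
      by (rule borel_measurable_continuous_onI[OF continuous_exp_conv])
    fix x
    have s: "summable (\<lambda>n. norm (exp_term t n x))"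
      by (rule summable_comparison_test'[OF summable_bnd[of t], of 0]) (simp add: norm_exp_term_le)
    have "norm (exp_conv t x) \<le> (\<Sum>n. norm (exp_term t n x))"
      unfolding exp_conv_def by (rule summable_norm[OF s])
    also have "\<dots> \<le> (\<Sum>n. bnd t n)"
      by (rule suminf_le[OF norm_exp_term_le s summable_bnd])
    finally show "norm (exp_conv t x) \<le> (\<Sum>n. bnd t n)" .
  qed
  then have int_g: "integrable (lebesgue_on {0..r}) g"
    unfolding g_def by simp
  have int_v: "integrable (lebesgue_on {0..r}) v"
    by (rule square_integrable_torus_imp_integrable[OF v])
  have coeff_g: "fourier_coeff r g k = fourier_coeff r v k" for k
  proof -
    let ?m = "nonlocal_multiplier \<delta> \<beta> (freq r k)"
    \<comment> \<open>Both sides equal exp (m t) - exp (- \<alpha> t).\<close>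
    have "exp (- ?a * t) * (exp (t * (?m + ?a)) - 1) = (1 - exp (- (?m + ?a) * t)) * exp (?m * t)"
      by (simp add: right_diff_distrib left_diff_distrib exp_add[symmetric] algebra_simps)
    then show ?thesis
      unfolding coeff g_def fourier_coeff_cmult
        fourier_coeff_exp_conv[OF fourier_transform_nonlocal_kernel[OF \<open>\<delta> > 0\<close> \<open>\<beta> < 1\<close>]]
      by (simp only: mult.assoc[symmetric] of_real_mult[symmetric]) (simp only: mult.commute)
  qed
  \<comment> \<open>The difference is written as a sum with a multiple to fit the additivity and
    scaling rules for coefficients.\<close>
  have "AE x in lebesgue_on {0..r}. g x + (- 1) * v x = 0"
  proof (rule fourier_coeff_eq_0_imp_AE_eq_0)
    have int_v': "integrable (lebesgue_on {0..r}) (\<lambda>x. (- 1) * v x)"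
      using int_v by simp
    show "integrable (lebesgue_on {0..r}) (\<lambda>x. g x + (- 1) * v x)"
      by (rule Bochner_Integration.integrable_add[OF int_g int_v'])
    show "fourier_coeff r (\<lambda>x. g x + (- 1) * v x) k = 0" for k
      unfolding fourier_coeff_add[OF int_g int_v'] fourier_coeff_cmult coeff_g by simp
  qed fact
  then have "AE x in lebesgue_on {0..r}. g x = v x"
    by eventually_elim simp
  then have "AE x in lebesgue. g x = v x"
    by (rule AE_periodic_lebesgue) (simp_all add: per v.plus_1 \<open>r > 0\<close>)
  moreover have "periodic_fun_simple g r"
    by standard (rule per)
  ultimately show ?thesis using cont by blast
qed

theorem corollary1:
  fixes r \<delta> \<beta> :: real
    and f :: "real \<Rightarrow> complex"
    and u :: "real \<Rightarrow> real \<Rightarrow> complex"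
  assumes "r > 0" and "\<delta> > 0" and "\<beta> < 1"
    and "square_integrable_torus r f"
    and "piecewise_continuous_torus r f"
    and "nonlocal_solution r \<delta> \<beta> f u"
    and "pointwise_values r \<delta> \<beta> f u"
  shows "(\<forall>t>0. piecewise_continuous_torus r (u t) \<and> jumps r (u t) = jumps r f) \<and>
         (\<forall>x\<in>jumps r f. strict_antimono_on {0..} (\<lambda>t. jump_magnitude (u t) x))"
proof -
  let ?a = "decay_rate \<delta> \<beta>"
  obtain v where "\<And>t. t > 0 \<Longrightarrow> square_integrable_torus r (v t) \<and>
      (\<forall>k. fourier_coeff r (v t) k =
           fourier_coeff r f k *
           of_real ((1 - exp (- (nonlocal_multiplier \<delta> \<beta> (freq r k) + ?a) * t)) *
                    exp (nonlocal_multiplier \<delta> \<beta> (freq r k) * t))) \<and>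
      ((\<exists>g. periodic_fun_simple g r \<and> continuous_on UNIV g \<and> (AE x in lebesgue. g x = v t x))
           \<longrightarrow> continuous_on UNIV (v t)) \<and>
      (\<forall>x. u t x = v t x + of_real (exp (- ?a * t)) * f x)"
    using assms(7) unfolding pointwise_values_def by auto
  note v = this[THEN conjunct1] this[THEN conjunct2, THEN conjunct1, rule_format]
    this[THEN conjunct2, THEN conjunct2, THEN conjunct1]
    this[THEN conjunct2, THEN conjunct2, THEN conjunct2, rule_format]
  have cont: "continuous_on UNIV (v t)" if "t > 0" for t
    using smooth_part_continuous_representative[OF assms(1-3,5) v(1,2)[OF that]] v(3)[OF that]
    by blast
  have per: "periodic_fun_simple (v t) r" if "t > 0" for t
    using v(1)[OF that] by (simp add: square_integrable_torus_def)
  have c: "complex_of_real (exp (- ?a * t)) \<noteq> 0" for t by simp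
  note facts = assms(5) cont per c v(4)
  have "piecewise_continuous_torus r (u t) \<and> jumps r (u t) = jumps r f" if "t > 0" for t
    using piecewise_continuous_torus_add_scaled[OF facts] jumps_add_scaled[OF facts] that by blast
  \<comment> \<open>The decomposition of \<open>u\<close> is available only for t > 0; at t = 0 the
    formula comes from \<open>u 0 = f\<close>. Strict decay on all of {0..} then follows from
    \<alpha> > 0 and the positivity of the jump of f.\<close>
  moreover have mag: "jump_magnitude (u t) x = exp (- ?a * t) * jump_magnitude f x"
    if "x \<in> jumps r f" "t \<ge> 0" for x t
  proof (cases "t = 0")
    case True
    then show ?thesis using assms(6) by (simp add: nonlocal_solution_def)
  next
    case False
    then show ?thesis
      using jump_magnitude_add_scaled[OF facts(1) facts(2-5)[of t] that(1)] that(2) by simp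
  qed
  moreover have "?a > 0"
    using assms(2,3) by (simp add: decay_rate_def)
  ultimately show ?thesis
    using jump_magnitude_pos by (auto intro!: monotone_onI simp: mag)
qed

end
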